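(* If $G$ is an interval graph, then $D_{\ell}(G) = D(G)$.
   Context: All graphs are finite and simple. An interval graph is a graph admitting an assignment of intervals of the real line to its vertices such that two vertices are adjacent if and only if their intervals intersect. A $k$-coloring of $G$ is a map $\phi: V(G)\to\{1,\dots,k\}$; it is distinguishing if every nontrivial automorphism of $G$ maps some vertex to a vertex of a different color. The distinguishing number $D(G)$ is the minimum $k$ such that $G$ has a distinguishing $k$-coloring. A list assignment $L=\{L(v)\}_{v\in V(G)}$ assigns a set of colors $L(v)$ to each vertex; a distinguishing $L$-coloring is a distinguishing coloring in which each vertex $v$ receives a color from $L(v)$. The list distinguishing number $D_\ell(G)$ is the minimum $k$ such that for every list assignment $L$ with $|L(v)|=k$ for all $v\in V(G)$, $G$ has a distinguishing $L$-coloring. *)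

theory Defs
  imports "Graph_Theory.Graph_Theory" "HOL-Analysis.Analysis"
begin

text \<open>
  Finite simple graphs are the finite, symmetric, loop-free pair digraphs, i.e. those satisfying
  the locale predicate \<open>pair_graph\<close>; \<open>u\<close> and \<open>v\<close> are adjacent iff \<open>(u, v) \<in> parcs G\<close>.
\<close>

definition interval_graph :: "'a pair_pre_digraph \<Rightarrow> bool" where
  "interval_graph G \<longleftrightarrow>
     (\<exists>I :: 'a \<Rightarrow> real set.
        (\<forall>v\<in>pverts G. is_interval (I v) \<and> I v \<noteq> {}) \<and>
        (\<forall>u\<in>pverts G. \<forall>v\<in>pverts G. u \<noteq> v \<longrightarrow> ((u, v) \<in> parcs G \<longleftrightarrow> I u \<inter> I v \<noteq> {})))"

definition graph_automorphism :: "'a pair_pre_digraph \<Rightarrow> ('a \<Rightarrow> 'a) \<Rightarrow> bool" where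
  "graph_automorphism G \<sigma> \<longleftrightarrow>
     bij_betw \<sigma> (pverts G) (pverts G) \<and>
     (\<forall>u\<in>pverts G. \<forall>v\<in>pverts G. (\<sigma> u, \<sigma> v) \<in> parcs G \<longleftrightarrow> (u, v) \<in> parcs G)"

definition distinguishing :: "'a pair_pre_digraph \<Rightarrow> ('a \<Rightarrow> 'c) \<Rightarrow> bool" where
  "distinguishing G \<phi> \<longleftrightarrow>
     (\<forall>\<sigma>. graph_automorphism G \<sigma> \<and> (\<exists>v\<in>pverts G. \<sigma> v \<noteq> v) \<longrightarrow>
        (\<exists>v\<in>pverts G. \<phi> (\<sigma> v) \<noteq> \<phi> v))"

definition distinguishing_L_coloring ::
    "'a pair_pre_digraph \<Rightarrow> ('a \<Rightarrow> 'c set) \<Rightarrow> ('a \<Rightarrow> 'c) \<Rightarrow> bool" where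
  "distinguishing_L_coloring G L \<phi> \<longleftrightarrow> (\<forall>v\<in>pverts G. \<phi> v \<in> L v) \<and> distinguishing G \<phi>"

definition distinguishable :: "'a pair_pre_digraph \<Rightarrow> nat \<Rightarrow> bool" where
  "distinguishable G k \<longleftrightarrow> (\<exists>\<phi> :: 'a \<Rightarrow> nat. \<phi> ` pverts G \<subseteq> {1..k} \<and> distinguishing G \<phi>)"

definition distinguishing_number :: "'a pair_pre_digraph \<Rightarrow> nat" where
  "distinguishing_number G = (LEAST k. distinguishable G k)"

text \<open>
  Colors are natural numbers. This loses no generality for finite graphs: see
  \<open>list_distinguishable_any_colors\<close> below. The finiteness of the lists matters only for
  \<open>k = 0\<close>, because \<open>card\<close> of an infinite set is \<open>0\<close>.
\<close>

definition list_distinguishable :: "'a pair_pre_digraph \<Rightarrow> nat \<Rightarrow> bool" where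
  "list_distinguishable G k \<longleftrightarrow>
     (\<forall>L :: 'a \<Rightarrow> nat set. (\<forall>v\<in>pverts G. finite (L v) \<and> card (L v) = k) \<longrightarrow>
        (\<exists>\<phi>. distinguishing_L_coloring G L \<phi>))"

definition list_distinguishing_number :: "'a pair_pre_digraph \<Rightarrow> nat" where
  "list_distinguishing_number G = (LEAST k. list_distinguishable G k)"

lemma list_distinguishable_any_colors:
  fixes L :: "'a \<Rightarrow> 'c set"
  assumes fin: "finite (pverts G)"
    and k: "list_distinguishable G k"
    and L: "\<And>v. v \<in> pverts G \<Longrightarrow> finite (L v) \<and> card (L v) = k"
  shows "\<exists>\<phi>. distinguishing_L_coloring G L \<phi>"
proof -
  define C where "C = (\<Union>v\<in>pverts G. L v)"
  have "finite C" using fin L by (auto simp: C_def)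
  then obtain f :: "'c \<Rightarrow> nat" where f: "inj_on f C"
    using finite_imp_inj_to_nat_seg by blast
  have "finite (f ` L v) \<and> card (f ` L v) = k" if "v \<in> pverts G" for v
  proof -
    have "L v \<subseteq> C" using that by (auto simp: C_def)
    then show ?thesis using L[OF that] card_image[OF inj_on_subset[OF f]] by auto
  qed
  with k obtain \<psi> where "distinguishing_L_coloring G (\<lambda>v. f ` L v) \<psi>"
    unfolding list_distinguishable_def by (auto dest!: spec[of _ "\<lambda>v. f ` L v"])
  then have \<psi>: "\<forall>v\<in>pverts G. \<psi> v \<in> f ` L v" "distinguishing G \<psi>"
    by (auto simp: distinguishing_L_coloring_def)
  have "\<forall>v\<in>pverts G. \<exists>c. c \<in> L v \<and> \<psi> v = f c" using \<psi>(1) by blast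
  then obtain \<phi> where \<phi>: "\<forall>v\<in>pverts G. \<phi> v \<in> L v \<and> \<psi> v = f (\<phi> v)"
    by (auto dest!: bchoice)
  have "distinguishing G \<phi>"
    unfolding distinguishing_def
  proof (intro allI impI)
    fix \<sigma> assume s: "graph_automorphism G \<sigma> \<and> (\<exists>v\<in>pverts G. \<sigma> v \<noteq> v)"
    then obtain v where v: "v \<in> pverts G" "\<psi> (\<sigma> v) \<noteq> \<psi> v"
      using \<psi>(2) by (auto simp: distinguishing_def)
    have "\<sigma> v \<in> pverts G"
      using s v(1) by (auto simp: graph_automorphism_def bij_betw_def)
    with v \<phi> have "\<phi> (\<sigma> v) \<noteq> \<phi> v" by auto
    with v(1) show "\<exists>v\<in>pverts G. \<phi> (\<sigma> v) \<noteq> \<phi> v" ..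
  qed
  with \<phi> show ?thesis by (auto simp: distinguishing_L_coloring_def)
qed

lemma inj_on_imp_distinguishing:
  assumes "inj_on \<phi> (pverts G)"
  shows "distinguishing G \<phi>"
  unfolding distinguishing_def
proof (intro allI impI)
  fix \<sigma> assume s: "graph_automorphism G \<sigma> \<and> (\<exists>v\<in>pverts G. \<sigma> v \<noteq> v)"
  then obtain v where v: "v \<in> pverts G" "\<sigma> v \<noteq> v" by blast
  moreover have "\<sigma> v \<in> pverts G"
    using s v(1) by (auto simp: graph_automorphism_def bij_betw_def)
  ultimately have "\<phi> (\<sigma> v) \<noteq> \<phi> v" using inj_on_eq_iff[OF assms] by simp
  with v(1) show "\<exists>v\<in>pverts G. \<phi> (\<sigma> v) \<noteq> \<phi> v" ..
qed

lemma ex_distinguishable: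
  assumes "finite (pverts G)"
  shows "\<exists>k. distinguishable G k"
proof -
  obtain f where "bij_betw f (pverts G) {1..card (pverts G)}"
    using finite_same_card_bij[OF assms, of "{1..card (pverts G)}"] by auto
  then have "f ` pverts G \<subseteq> {1..card (pverts G)}" "distinguishing G f"
    by (simp_all add: bij_betw_def inj_on_imp_distinguishing)
  then show ?thesis
    unfolding distinguishable_def by blast
qed

lemma ex_list_distinguishable:
  assumes "finite (pverts G)"
  shows "\<exists>k. list_distinguishable G k"
proof -
  have sdr: "\<exists>\<phi>. inj_on \<phi> S \<and> (\<forall>v\<in>S. \<phi> v \<in> L v)"
    if "finite S" "\<And>v. v \<in> S \<Longrightarrow> card S \<le> card (L v)" for S and L :: "'a \<Rightarrow> nat set"
    using that
  proof (induction S rule: finite_induct)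
    case (insert x S)
    have "card S \<le> card (L v)" if "v \<in> S" for v
      using insert.prems[of v] insert.hyps that by simp
    then obtain \<phi> where \<phi>: "inj_on \<phi> S" "\<forall>v\<in>S. \<phi> v \<in> L v"
      using insert.IH by blast
    have "card (\<phi> ` S) < card (L x)"
      using insert.hyps insert.prems[of x] card_image_le[of S \<phi>] by simp
    then have "\<not> L x \<subseteq> \<phi> ` S"
      using card_mono[of "\<phi> ` S" "L x"] insert.hyps(1) by auto
    then obtain c where c: "c \<in> L x" "c \<notin> \<phi> ` S" by blast
    have "inj_on (\<phi>(x := c)) (insert x S)"
      using \<phi>(1) c(2) insert.hyps(2) by (auto simp: inj_on_def)
    moreover have "\<forall>v\<in>insert x S. (\<phi>(x := c)) v \<in> L v"
      using \<phi>(2) c(1) by auto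
    ultimately show ?case by blast
  qed auto
  have "list_distinguishable G (card (pverts G))"
    unfolding list_distinguishable_def distinguishing_L_coloring_def
  proof (intro allI impI)
    fix L :: "'a \<Rightarrow> nat set"
    assume "\<forall>v\<in>pverts G. finite (L v) \<and> card (L v) = card (pverts G)"
    then obtain \<phi> where "inj_on \<phi> (pverts G)" "\<forall>v\<in>pverts G. \<phi> v \<in> L v"
      using sdr[OF assms, of L] by auto
    then show "\<exists>\<phi>. (\<forall>v\<in>pverts G. \<phi> v \<in> L v) \<and> distinguishing G \<phi>"
      using inj_on_imp_distinguishing by blast
  qed
  then show ?thesis ..
qed

end

theory Submission
  imports Defs
begin

text \<open>
  Count distinguishing \<open>L\<close>-colorings up to automorphism. For vertex-labelled interval graphs, this
  number is at least the number of classes of distinguishing colorings from lists \<open>F\<close> that depend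
  only on the label, whenever \<open>card (F (l v)) \<le> card (L v)\<close> for all \<open>v\<close>. The proof is by
  induction on the number of vertices. If there is a module \<open>M\<close> whose images under automorphisms
  are equal or disjoint, contract all of these images: a coloring of \<open>G\<close> becomes a coloring of the
  contracted graph in which a contracted vertex is colored by the class of the coloring of its
  module, and this preserves the number of classes exactly. Components, co-components and (when the
  graph and its complement are connected) maximal modules have this property. What remains are
  graphs on which the automorphism group is trivial, the full symmetric group, or, for prime
  interval graphs, of order at most two; these are settled by direct counting.

  For a prime interval graph an automorphism either preserves or reverses the interval order.
  Indeed, color a pair of vertices by whether it is adjacent, is ordered consistently by the
  automorphism, or is reversed by it. No triangle is rainbow, so by Gallai's theorem one color class
  is disconnected, and its components are modules. An automorphism that preserves the interval order
  moves vertices only to twins, hence is trivial.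
\<close>

section \<open>Classes of distinguishing list colorings\<close>

locale simple_graph_relation =
  fixes E :: "'a \<Rightarrow> 'a \<Rightarrow> bool"
  assumes E_sym: "E u v \<Longrightarrow> E v u"
    and E_irrefl: "\<not> E v v"
begin

lemma E_commute: "E u v \<longleftrightarrow> E v u"
  using E_sym by blast

text \<open>By \<open>permutes\<close>, automorphisms are the identity outside \<open>V\<close>.
  Each is thus a single function, so \<open>auts V l\<close> is finite and can be counted.\<close>

definition auts :: "'a set \<Rightarrow> ('a \<Rightarrow> nat) \<Rightarrow> ('a \<Rightarrow> 'a) set" where
  "auts V l = {s. s permutes V \<and> (\<forall>u\<in>V. \<forall>v\<in>V. E (s u) (s v) \<longleftrightarrow> E u v) \<and> (\<forall>v\<in>V. l (s v) = l v)}"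

definition dist_coloring :: "'a set \<Rightarrow> ('a \<Rightarrow> nat) \<Rightarrow> ('a \<Rightarrow> nat) \<Rightarrow> bool" where
  "dist_coloring V l p \<longleftrightarrow>
     (\<forall>s\<in>auts V l. (\<forall>v\<in>V. p (s v) = p v) \<longrightarrow> (\<forall>v\<in>V. s v = v))"

text \<open>A complete invariant of colorings of \<open>V\<close> up to automorphism, with values in \<open>nat\<close> so that
  it can itself serve as a color.\<close>

definition code :: "'a set \<Rightarrow> ('a \<Rightarrow> nat) \<Rightarrow> ('a \<Rightarrow> nat) \<Rightarrow> nat" where
  "code V l p = (LEAST n. \<exists>s\<in>auts V l. n = to_nat (map (p \<circ> s) (SOME xs. set xs = V)))"

definition dist_L_colorings :: "'a set \<Rightarrow> ('a \<Rightarrow> nat) \<Rightarrow> ('a \<Rightarrow> nat set) \<Rightarrow> ('a \<Rightarrow> nat) set" where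
  "dist_L_colorings V l L = {p. (\<forall>v\<in>V. p v \<in> L v) \<and> dist_coloring V l p}"

definition num_classes :: "'a set \<Rightarrow> ('a \<Rightarrow> nat) \<Rightarrow> ('a \<Rightarrow> nat set) \<Rightarrow> nat" where
  "num_classes V l L = card (code V l ` dist_L_colorings V l L)"

text \<open>\<open>F\<close> is arbitrary because a contraction gives its fresh label the set of
  coloring classes of a module as its list. Sizes are compared by an inequality because the
  induction yields no more at a contracted vertex. The lists \<open>F (l v)\<close> are constant on
  orbits; the lists \<open>L v\<close> need not be.\<close>

definition list_good :: "'a set \<Rightarrow> ('a \<Rightarrow> nat) \<Rightarrow> bool" where
  "list_good V l \<longleftrightarrow>
     (\<forall>F L. (\<forall>i. finite (F i)) \<longrightarrow>
        (\<forall>v\<in>V. finite (L v) \<and> card (F (l v)) \<le> card (L v)) \<longrightarrow>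
        num_classes V l (\<lambda>v. F (l v)) \<le> num_classes V l L)"

section \<open>The group of automorphisms of a labelled graph\<close>

lemma autsI:
  assumes "s permutes V" "\<And>u v. u \<in> V \<Longrightarrow> v \<in> V \<Longrightarrow> E (s u) (s v) \<longleftrightarrow> E u v"
    "\<And>v. v \<in> V \<Longrightarrow> l (s v) = l v"
  shows "s \<in> auts V l"
  using assms by (simp add: auts_def)

lemma
  assumes "s \<in> auts V l"
  shows auts_permutes: "s permutes V"
    and auts_E: "u \<in> V \<Longrightarrow> v \<in> V \<Longrightarrow> E (s u) (s v) \<longleftrightarrow> E u v"
    and auts_label: "v \<in> V \<Longrightarrow> l (s v) = l v"
    and auts_in: "s v \<in> V \<longleftrightarrow> v \<in> V"
    and auts_inj: "s u = s v \<longleftrightarrow> u = v"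
    and auts_inv_left: "inv s (s v) = v"
    and auts_inv_right: "s (inv s v) = v"
proof -
  show s: "s permutes V" using assms by (simp add: auts_def)
  show "u \<in> V \<Longrightarrow> v \<in> V \<Longrightarrow> E (s u) (s v) \<longleftrightarrow> E u v" "v \<in> V \<Longrightarrow> l (s v) = l v"
    using assms by (auto simp: auts_def)
  show "s v \<in> V \<longleftrightarrow> v \<in> V" using permutes_in_image[OF s] .
  show "s u = s v \<longleftrightarrow> u = v" using permutes_inj[OF s] by (auto simp: inj_def)
  show "inv s (s v) = v" "s (inv s v) = v" using permutes_inverses[OF s] by auto
qed

lemma id_in_auts: "id \<in> auts V l"
  by (simp add: auts_def permutes_id)

lemma comp_in_auts:
  assumes "s \<in> auts V l" "t \<in> auts V l"
  shows "s \<circ> t \<in> auts V l"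
proof (rule autsI)
  show "s \<circ> t permutes V" using assms by (simp add: auts_def permutes_compose)
qed (use assms in \<open>auto simp: auts_E auts_label auts_in\<close>)

lemma inv_in_auts:
  assumes "s \<in> auts V l"
  shows "inv s \<in> auts V l"
proof (rule autsI)
  show p: "inv s permutes V" using assms by (simp add: auts_def permutes_inv)
  have m: "inv s v \<in> V" if "v \<in> V" for v using permutes_in_image[OF p] that by simp
  show "E (inv s u) (inv s v) = E u v" if "u \<in> V" "v \<in> V" for u v
    using auts_E[OF assms m[OF that(1)] m[OF that(2)]] by (simp add: auts_inv_right[OF assms])
  show "l (inv s v) = l v" if "v \<in> V" for v
    using auts_label[OF assms m[OF that]] by (simp add: auts_inv_right[OF assms])
qed

lemma auts_eq_idI:
  assumes "s \<in> auts V l" "\<And>v. v \<in> V \<Longrightarrow> s v = v"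
  shows "s = id"
  using auts_permutes[OF assms(1)] assms(2) by (auto simp: permutes_def fun_eq_iff)

lemma finite_auts: "finite V \<Longrightarrow> finite (auts V l)"
  by (rule finite_subset[OF _ finite_permutations[of V]]) (auto simp: auts_def)

text \<open>\<open>C p\<close> holds of the encoded words of all colorings in the orbit of
  \<open>p\<close>, read along one fixed enumeration of \<open>V\<close>. The code is one of them,
  so equal codes give a common word and hence an automorphism; conversely, colorings in one orbit
  have the same words.\<close>

lemma code_eq_iff:
  assumes "finite V"
  shows "code V l p = code V l q \<longleftrightarrow> (\<exists>s\<in>auts V l. \<forall>v\<in>V. p (s v) = q v)"
proof -
  define xs where "xs = (SOME xs. set xs = V)"
  have xs: "set xs = V" unfolding xs_def using someI_ex[OF finite_list[OF assms]] .
  define C where "C p n \<longleftrightarrow> (\<exists>s\<in>auts V l. n = to_nat (map (p \<circ> s) xs))" for p :: "'a \<Rightarrow> nat" and n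
  have code: "code V l p = (LEAST n. C p n)" for p
    by (simp add: code_def C_def xs_def)
  have "C p (code V l p)" for p
    unfolding code by (rule LeastI_ex) (use id_in_auts in \<open>auto simp: C_def\<close>)
  then have 1: "\<exists>s\<in>auts V l. code V l p = to_nat (map (p \<circ> s) xs)" for p
    by (simp add: C_def)
  show ?thesis
  proof
    assume eq: "code V l p = code V l q"
    from 1[of p] 1[of q] eq obtain s t where st: "s \<in> auts V l" "t \<in> auts V l"
      "map (p \<circ> s) xs = map (q \<circ> t) xs" by auto
    then have *: "p (s v) = q (t v)" if "v \<in> V" for v using that xs by auto
    have "p ((s \<circ> inv t) v) = q v" if "v \<in> V" for v
      using *[of "inv t v"] that st auts_in[OF inv_in_auts[OF st(2)]] auts_inv_right[OF st(2)] by auto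
    with comp_in_auts[OF st(1) inv_in_auts[OF st(2)]] show "\<exists>s\<in>auts V l. \<forall>v\<in>V. p (s v) = q v"
      by blast
  next
    assume "\<exists>s\<in>auts V l. \<forall>v\<in>V. p (s v) = q v"
    then obtain s where s: "s \<in> auts V l" "\<forall>v\<in>V. p (s v) = q v" by blast
    have "C p n" if "C q n" for n
    proof -
      from that obtain t where t: "t \<in> auts V l" "n = to_nat (map (q \<circ> t) xs)" by (auto simp: C_def)
      have "map (q \<circ> t) xs = map (p \<circ> (s \<circ> t)) xs" using s t xs by (auto simp: auts_in)
      then show ?thesis using t comp_in_auts[OF s(1) t(1)] unfolding C_def by metis
    qed
    moreover have "C q n" if "C p n" for n
    proof -
      from that obtain t where t: "t \<in> auts V l" "n = to_nat (map (p \<circ> t) xs)" by (auto simp: C_def)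
      have "q ((inv s \<circ> t) v) = p (t v)" if "v \<in> V" for v
        using s that t auts_in[OF inv_in_auts[OF s(1)]] auts_in[OF t(1)]
        by (metis auts_inv_right comp_apply)
      then have "map (p \<circ> t) xs = map (q \<circ> (inv s \<circ> t)) xs" using xs by auto
      then show ?thesis using t comp_in_auts[OF inv_in_auts[OF s(1)] t(1)] unfolding C_def by metis
    qed
    ultimately have "C p = C q" by blast
    then show "code V l p = code V l q" by (simp add: code)
  qed
qed

lemma code_cong:
  assumes "finite V" "\<And>v. v \<in> V \<Longrightarrow> p v = q v"
  shows "code V l p = code V l q"
  unfolding code_eq_iff[OF assms(1)] using assms(2) by (auto intro!: bexI[OF _ id_in_auts])

lemma dist_coloring_cong:
  assumes "\<And>v. v \<in> V \<Longrightarrow> p v = q v"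
  shows "dist_coloring V l p \<longleftrightarrow> dist_coloring V l q"
  unfolding dist_coloring_def using assms by (intro ball_cong refl) (simp add: auts_in)

text \<open>Members of \<open>dist_L_colorings\<close> are unrestricted outside \<open>V\<close>.
  Extensional functions represent the same codes and form a finite set.\<close>

lemma code_image_eq_PiE:
  assumes "finite V"
  shows "code V l ` dist_L_colorings V l L = code V l ` {p \<in> PiE V L. dist_coloring V l p}"
    (is "?A = ?B")
proof
  show "?A \<subseteq> ?B"
  proof
    fix c assume "c \<in> ?A"
    then obtain p where p: "c = code V l p" "\<forall>v\<in>V. p v \<in> L v" "dist_coloring V l p"
      by (auto simp: dist_L_colorings_def)
    have "c = code V l (restrict p V)" unfolding p(1) by (rule code_cong[OF assms]) auto
    moreover have "dist_coloring V l (restrict p V)"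
      using p(3) dist_coloring_cong[of V p "restrict p V"] by auto
    ultimately show "c \<in> ?B" using p(2) by auto
  qed
  show "?B \<subseteq> ?A" by (auto simp: dist_L_colorings_def PiE_iff)
qed

lemma finite_code_image:
  assumes "finite V" "\<And>v. v \<in> V \<Longrightarrow> finite (L v)"
  shows "finite (code V l ` dist_L_colorings V l L)"
  unfolding code_image_eq_PiE[OF assms(1)] using finite_PiE[OF assms(1), of L] assms(2) by auto

section \<open>Numbers of classes against numbers of colorings\<close>

lemma num_classes_mono:
  assumes "finite V" "\<And>v. v \<in> V \<Longrightarrow> finite (L v)" "\<And>v. v \<in> V \<Longrightarrow> L' v \<subseteq> L v"
  shows "num_classes V l L' \<le> num_classes V l L"
  unfolding num_classes_def
  by (rule card_mono[OF finite_code_image[OF assms(1,2)]])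
    (use assms(3) in \<open>auto simp: dist_L_colorings_def intro!: imageI\<close>)

text \<open>Every coloring is the representative of its class followed by an automorphism, so a
  class has at most \<open>card (auts V l)\<close> members. It may have fewer, as arbitrary lists
  need not be invariant.\<close>

lemma card_dist_colorings_le:
  assumes V: "finite V" and L: "\<And>v. v \<in> V \<Longrightarrow> finite (L v)"
  shows "card {p \<in> PiE V L. dist_coloring V l p} \<le> num_classes V l L * card (auts V l)"
proof -
  define D where "D = {p \<in> PiE V L. dist_coloring V l p}"
  define r where "r c = (SOME p. p \<in> D \<and> code V l p = c)" for c
  have r: "r c \<in> D" "code V l (r c) = c" if "c \<in> code V l ` D" for c
    using someI_ex[of "\<lambda>p. p \<in> D \<and> code V l p = c"] that unfolding r_def by auto
  have num: "num_classes V l L = card (code V l ` D)"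
    unfolding num_classes_def code_image_eq_PiE[OF V] D_def ..
  have fin: "finite (code V l ` D)" 
    using finite_code_image[OF assms, where l = l] unfolding code_image_eq_PiE[OF V] D_def .
  have "D \<subseteq> (\<lambda>(c, s). restrict (r c \<circ> s) V) ` (code V l ` D \<times> auts V l)"
  proof
    fix p assume p: "p \<in> D"
    then have "code V l (r (code V l p)) = code V l p" using r by auto
    then obtain s where s: "s \<in> auts V l" "\<forall>v\<in>V. r (code V l p) (s v) = p v"
      using code_eq_iff[OF V] by metis
    have "p = restrict (r (code V l p) \<circ> s) V"
      using s(2) p by (auto simp: D_def fun_eq_iff PiE_def extensional_def)
    then show "p \<in> (\<lambda>(c, s). restrict (r c \<circ> s) V) ` (code V l ` D \<times> auts V l)"
      using p s(1) by (intro image_eqI[of _ _ "(code V l p, s)"]) auto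
  qed
  then have "card D \<le> card (code V l ` D \<times> auts V l)"
    using fin finite_auts[OF V] by (meson card_image_le card_mono finite_SigmaI finite_imageI order_trans)
  then show ?thesis unfolding num by (simp add: D_def card_cartesian_product)
qed

text \<open>Lists that depend on labels only are invariant, so whole orbits are counted. The group
  acts freely on distinguishing colorings, hence each orbit has \<open>card (auts V l)\<close>
  members.\<close>

lemma card_dist_colorings_ge:
  assumes V: "finite V" and F: "\<And>i. finite (F i)"
  shows "num_classes V l (\<lambda>v. F (l v)) * card (auts V l)
    \<le> card {p \<in> (\<Pi>\<^sub>E v\<in>V. F (l v)). dist_coloring V l p}"
proof -
  define D where "D = {p \<in> (\<Pi>\<^sub>E v\<in>V. F (l v)). dist_coloring V l p}"
  define r where "r c = (SOME p. p \<in> D \<and> code V l p = c)" for c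
  have r: "r c \<in> D" "code V l (r c) = c" if "c \<in> code V l ` D" for c
    using someI_ex[of "\<lambda>p. p \<in> D \<and> code V l p = c"] that unfolding r_def by auto
  have num: "num_classes V l (\<lambda>v. F (l v)) = card (code V l ` D)"
    unfolding num_classes_def code_image_eq_PiE[OF V] D_def ..
  define f where "f = (\<lambda>(c, s). restrict (r c \<circ> s) V)"
  have f: "f (c, s) v = r c (s v)" if "v \<in> V" for c s v using that by (simp add: f_def)
  have inj: "inj_on f (code V l ` D \<times> auts V l)"
  proof (rule inj_onI, clarify)
    fix p s q t
    assume pq: "p \<in> D" "q \<in> D" and st: "s \<in> auts V l" "t \<in> auts V l"
      and "f (code V l p, s) = f (code V l q, t)"
    then have eq: "r (code V l p) (s v) = r (code V l q) (t v)" if "v \<in> V" for v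
      using f that by metis
    have st': "s \<circ> inv t \<in> auts V l" using st by (intro comp_in_auts inv_in_auts)
    have *: "r (code V l p) ((s \<circ> inv t) v) = r (code V l q) v" if "v \<in> V" for v
      using eq[of "inv t v"] that auts_in[OF inv_in_auts[OF st(2)]] auts_inv_right[OF st(2)] by auto
    then have "code V l (r (code V l p)) = code V l (r (code V l q))"
      unfolding code_eq_iff[OF V] using st' by blast
    then have c: "code V l p = code V l q" using r pq by auto
    have "dist_coloring V l (r (code V l q))" using r(1) pq by (auto simp: D_def)
    then have "\<forall>v\<in>V. (s \<circ> inv t) v = v"
      using * st' unfolding dist_coloring_def c by blast
    then have "s \<circ> inv t = id" using auts_eq_idI[OF st'] by auto
    then have "s = t" using auts_inv_left[OF st(2)] by (metis comp_apply eq_id_iff ext)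
    with c show "code V l p = code V l q \<and> s = t" by simp
  qed
  have "f ` (code V l ` D \<times> auts V l) \<subseteq> D"
  proof clarify
    fix p s assume p: "p \<in> D" and s: "s \<in> auts V l"
    define q where "q = r (code V l p)"
    have q: "q \<in> D" unfolding q_def using r p by auto
    have "q (s v) \<in> F (l v)" if "v \<in> V" for v
      using q that auts_label[OF s that] auts_in[OF s, of v] by (auto simp: D_def PiE_iff)
    \<comment> \<open>Color-preserving automorphisms of \<open>q \<circ> s\<close> are conjugate
      under \<open>s\<close> to those of \<open>q\<close>.\<close>
    moreover have "dist_coloring V l (q \<circ> s)"
      unfolding dist_coloring_def
    proof (intro ballI impI)
      fix t v assume t: "t \<in> auts V l" "\<forall>v\<in>V. (q \<circ> s) (t v) = (q \<circ> s) v" and v: "v \<in> V"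
      have c: "s \<circ> t \<circ> inv s \<in> auts V l" using s t by (intro comp_in_auts inv_in_auts)
      have "q ((s \<circ> t \<circ> inv s) v) = q v" if "v \<in> V" for v
        using t(2) that auts_in[OF inv_in_auts[OF s]] auts_inv_right[OF s] by auto
      then have "(s \<circ> t \<circ> inv s) (s v) = s v"
        using q c v auts_in[OF s] by (auto simp: D_def dist_coloring_def)
      then show "t v = v" using auts_inv_left[OF s] auts_inj[OF s] by auto
    qed
    then have "dist_coloring V l (f (code V l p, s))"
      using dist_coloring_cong[of V "q \<circ> s" "f (code V l p, s)"] f q_def by auto
    ultimately show "f (code V l p, s) \<in> D" by (auto simp: D_def f_def q_def)
  qed
  moreover have "finite D" unfolding D_def using finite_PiE[OF V, of "\<lambda>v. F (l v)"] F by auto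
  ultimately have "card (code V l ` D \<times> auts V l) \<le> card D" using inj card_inj_on_le by blast
  then show ?thesis unfolding num by (simp add: D_def card_cartesian_product)
qed

text \<open>The two bounds above have the same factor \<open>card (auts V l)\<close>. After
  cancelling it, classes can be compared by counting colorings.\<close>

lemma list_goodI_card:
  assumes V: "finite V"
    and *: "\<And>F L. (\<And>i. finite (F i)) \<Longrightarrow> (\<And>v. v \<in> V \<Longrightarrow> finite (L v) \<and> card (L v) = card (F (l v))) \<Longrightarrow>
      card {p \<in> (\<Pi>\<^sub>E v\<in>V. F (l v)). dist_coloring V l p} \<le> card {p \<in> PiE V L. dist_coloring V l p}"
  shows "list_good V l"
  unfolding list_good_def
proof (intro allI impI)
  fix F :: "nat \<Rightarrow> nat set" and L :: "'a \<Rightarrow> nat set"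
  assume F: "\<forall>i. finite (F i)" and L: "\<forall>v\<in>V. finite (L v) \<and> card (F (l v)) \<le> card (L v)"
  \<comment> \<open>Shrinking the lists to the exact reference sizes can only lose classes.\<close>
  have "\<forall>v\<in>V. \<exists>A. A \<subseteq> L v \<and> finite A \<and> card A = card (F (l v))"
    using L by (meson obtain_subset_with_card_n)
  then obtain L' where L': "\<And>v. v \<in> V \<Longrightarrow> L' v \<subseteq> L v \<and> finite (L' v) \<and> card (L' v) = card (F (l v))"
    by metis
  have "num_classes V l (\<lambda>v. F (l v)) * card (auts V l) \<le> num_classes V l L' * card (auts V l)"
    using card_dist_colorings_ge[OF V, of F l] card_dist_colorings_le[OF V, of L' l] *[of F L'] F L'
    by (meson order_trans)
  moreover have "card (auts V l) > 0" using finite_auts[OF V] id_in_auts by (metis card_gt_0_iff empty_iff)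
  ultimately have "num_classes V l (\<lambda>v. F (l v)) \<le> num_classes V l L'" by simp
  also have "\<dots> \<le> num_classes V l L" using num_classes_mono[OF V] L L' by blast
  finally show "num_classes V l (\<lambda>v. F (l v)) \<le> num_classes V l L" .
qed

end

section \<open>Contraction of block modules\<close>

text \<open>\<open>R\<close> induces a bijection between the values of \<open>f\<close> on
  \<open>A\<close> and those of \<open>g\<close> on \<open>B\<close>: it is total on both sides and
  respects equality of values.\<close>

lemma card_image_eq_of_correspondence:
  assumes tot: "\<And>x. x \<in> A \<Longrightarrow> \<exists>y\<in>B. R x y" "\<And>y. y \<in> B \<Longrightarrow> \<exists>x\<in>A. R x y"
    and R: "\<And>x y x' y'. x \<in> A \<Longrightarrow> x' \<in> A \<Longrightarrow> y \<in> B \<Longrightarrow> y' \<in> B \<Longrightarrow> R x y \<Longrightarrow> R x' y' \<Longrightarrow>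
      f x = f x' \<longleftrightarrow> g y = g y'"
  shows "card (f ` A) = card (g ` B)"
proof -
  define r where "r c = (SOME x. x \<in> A \<and> f x = c)" for c
  have r: "r c \<in> A" "f (r c) = c" if "c \<in> f ` A" for c
    using someI_ex[of "\<lambda>x. x \<in> A \<and> f x = c"] that unfolding r_def by auto
  from tot(1) obtain h where h: "\<And>x. x \<in> A \<Longrightarrow> h x \<in> B \<and> R x (h x)" by metis
  have "bij_betw (\<lambda>c. g (h (r c))) (f ` A) (g ` B)"
  proof (rule bij_betw_imageI)
    show "inj_on (\<lambda>c. g (h (r c))) (f ` A)"
      by (rule inj_onI) (metis R h r)
    show "(\<lambda>c. g (h (r c))) ` f ` A = g ` B"
    proof
      show "(\<lambda>c. g (h (r c))) ` f ` A \<subseteq> g ` B" using h r by blast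
      show "g ` B \<subseteq> (\<lambda>c. g (h (r c))) ` f ` A"
      proof
        fix d assume "d \<in> g ` B"
        then obtain y where y: "y \<in> B" "d = g y" by blast
        then obtain x where x: "x \<in> A" "R x y" using tot(2) by blast
        have "g (h (r (f x))) = d"
          using R[of "r (f x)" x "h (r (f x))" y] r[of "f x"] h[of "r (f x)"] x y by auto
        then show "d \<in> (\<lambda>c. g (h (r c))) ` f ` A" using x by blast
      qed
    qed
  qed
  then show ?thesis by (rule bij_betw_same_card)
qed

context simple_graph_relation
begin

definition graph_module :: "'a set \<Rightarrow> 'a set \<Rightarrow> bool" where
  "graph_module V M \<longleftrightarrow> M \<subseteq> V \<and> (\<forall>v\<in>V - M. \<forall>x\<in>M. \<forall>y\<in>M. E v x \<longleftrightarrow> E v y)"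

text \<open>An automorphism of the module is the identity outside it, and no outside vertex
  distinguishes two vertices of the module.\<close>

lemma auts_module_subset:
  assumes "graph_module V M"
  shows "auts M l \<subseteq> auts V l"
proof
  fix b assume b: "b \<in> auts M l"
  have M: "M \<subseteq> V" using assms by (simp add: graph_module_def)
  have out: "b v = v" if "v \<notin> M" for v
    using auts_permutes[OF b] that by (simp add: permutes_def)
  show "b \<in> auts V l"
  proof (rule autsI)
    show "b permutes V" using auts_permutes[OF b] M by (rule permutes_subset)
    show "E (b u) (b v) \<longleftrightarrow> E u v" if uv: "u \<in> V" "v \<in> V" for u v
    proof -
      have *: "E u (b v) \<longleftrightarrow> E u v" if "u \<in> V - M" "v \<in> M" for u v
        using assms that auts_in[OF b, of v] unfolding graph_module_def by blast
      show ?thesis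
      proof (cases "u \<in> M"; cases "v \<in> M")
        assume "u \<in> M" "v \<in> M" then show ?thesis using auts_E[OF b] by blast
      next
        assume "u \<notin> M" "v \<in> M" then show ?thesis using * out uv by auto
      next
        assume "u \<in> M" "v \<notin> M" then show ?thesis using *[of v u] out uv E_commute by auto
      qed (auto simp: out)
    qed
    show "l (b v) = l v" if "v \<in> V" for v using auts_label[OF b, of v] out[of v] by (cases "v \<in> M") auto
  qed
qed

end

text \<open>
  The images of the module \<open>M\<close> under automorphisms are pairwise disjoint or equal. \<open>J\<close> contains one
  vertex of each image, and \<open>a j\<close> is an automorphism that carries \<open>M\<close> onto the image of \<open>j\<close>.
  The contracted graph \<open>V'\<close> keeps \<open>J\<close> only, with a fresh label \<open>z\<close>.
\<close>

locale block_contraction = simple_graph_relation E for E :: "'a \<Rightarrow> 'a \<Rightarrow> bool" +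
  fixes V M J U V' :: "'a set" and l l' :: "'a \<Rightarrow> nat" and m :: 'a and a :: "'a \<Rightarrow> 'a \<Rightarrow> 'a"
    and z :: nat and pi :: "'a \<Rightarrow> 'a"
  assumes finV: "finite V" and modM: "graph_module V M" and mM: "m \<in> M"
    and a_aut: "j \<in> J \<Longrightarrow> a j \<in> auts V l"
    and a_m: "j \<in> J \<Longrightarrow> a j m = j"
    and disj: "j \<in> J \<Longrightarrow> k \<in> J \<Longrightarrow> j \<noteq> k \<Longrightarrow> a j ` M \<inter> a k ` M = {}"
    and cover: "s \<in> auts V l \<Longrightarrow> \<exists>j\<in>J. s ` M = a j ` M"
    and fresh: "v \<in> V \<Longrightarrow> l v \<noteq> z"
  defines "U \<equiv> \<Union>j\<in>J. a j ` M"
    and "V' \<equiv> (V - U) \<union> J"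
    and "l' \<equiv> \<lambda>v. if v \<in> J then z else l v"
    and "pi \<equiv> \<lambda>v. if v \<in> U then (THE j. j \<in> J \<and> v \<in> a j ` M) else v"
begin

section \<open>The retraction \<open>pi\<close> onto the contracted graph\<close>

lemma M_sub: "M \<subseteq> V"
  using modM by (simp add: graph_module_def)

lemma finM: "finite M"
  using M_sub finV finite_subset by blast

lemma a_in_V: "j \<in> J \<Longrightarrow> x \<in> M \<Longrightarrow> a j x \<in> V"
  using a_aut M_sub auts_in by blast

lemma a_in_U: "j \<in> J \<Longrightarrow> x \<in> M \<Longrightarrow> a j x \<in> U"
  by (auto simp: U_def)

lemma U_sub: "U \<subseteq> V"
  using a_in_V by (auto simp: U_def)

lemma J_sub: "J \<subseteq> U"
  using a_in_U[OF _ mM] a_m by force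

lemma V'_sub: "V' \<subseteq> V"
  using J_sub U_sub by (auto simp: V'_def)

lemma finV': "finite V'"
  using V'_sub finV finite_subset by blast

lemma pi_a [simp]:
  assumes "j \<in> J" "x \<in> M" shows "pi (a j x) = j"
proof -
  have "(THE k. k \<in> J \<and> a j x \<in> a k ` M) = j"
  proof (rule the_equality)
    show "j \<in> J \<and> a j x \<in> a j ` M" using assms by blast
    show "k = j" if "k \<in> J \<and> a j x \<in> a k ` M" for k
      using disj[of k j] that assms by blast
  qed
  then show ?thesis using a_in_U[OF assms] by (simp add: pi_def)
qed

lemma pi_out: "v \<notin> U \<Longrightarrow> pi v = v"
  by (simp add: pi_def)

lemma pi_J: "j \<in> J \<Longrightarrow> pi j = j"
  using pi_a[OF _ mM] a_m by metis

lemma pi_V': "v \<in> V' \<Longrightarrow> pi v = v"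
  using pi_J pi_out by (auto simp: V'_def)

lemma U_cases:
  assumes "v \<in> U" obtains x where "pi v \<in> J" "x \<in> M" "v = a (pi v) x"
proof -
  from assms obtain j x where "j \<in> J" "x \<in> M" "v = a j x" by (auto simp: U_def)
  with pi_a that show ?thesis by metis
qed

lemma pi_in_J: "pi v \<in> J \<longleftrightarrow> v \<in> U"
  using U_cases[of v] pi_out[of v] J_sub by (metis in_mono)

lemma pi_in_V': "v \<in> V \<Longrightarrow> pi v \<in> V'"
  using pi_in_J[of v] pi_out[of v] by (auto simp: V'_def)

lemma pi_pi: "v \<in> V \<Longrightarrow> pi (pi v) = pi v"
  using pi_in_V' pi_V' by blast

lemma same_block_iff:
  assumes "j \<in> J" shows "v \<in> a j ` M \<longleftrightarrow> v \<in> U \<and> pi v = j"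
proof
  assume "v \<in> U \<and> pi v = j"
  with U_cases[of v] show "v \<in> a j ` M" by blast
qed (use assms pi_a a_in_U in auto)

text \<open>If \<open>w\<close> lies in a block, pulling back by \<open>inv (a (pi w))\<close> turns
  this block into \<open>M\<close> and puts \<open>v\<close> outside \<open>M\<close>. There
  \<open>v\<close> cannot distinguish the preimage of \<open>w\<close> from the base point
  \<open>m\<close>, which is sent to \<open>pi w\<close>.\<close>

lemma E_pi_right:
  assumes "v \<in> V" "w \<in> V" "pi v \<noteq> pi w"
  shows "E v w \<longleftrightarrow> E v (pi w)"
proof (cases "w \<in> U")
  case True
  then obtain x where x: "pi w \<in> J" "x \<in> M" "w = a (pi w) x" by (rule U_cases)
  let ?a = "a (pi w)"
  have a: "?a \<in> auts V l" using a_aut x by blast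
  define u where "u = inv ?a v"
  have u: "?a u = v" using auts_inv_right[OF a] by (simp add: u_def)
  have uV: "u \<in> V" using u assms(1) auts_in[OF a, of u] by simp
  have "v \<notin> ?a ` M" using assms(3) same_block_iff[OF x(1)] by auto
  then have "u \<notin> M" using u by blast
  then have "E u x \<longleftrightarrow> E u m" using modM uV x(2) mM unfolding graph_module_def by blast
  moreover have "E (?a u) (?a x) \<longleftrightarrow> E u x" "E (?a u) (?a m) \<longleftrightarrow> E u m"
    using auts_E[OF a] uV x(2) mM M_sub by blast+
  ultimately show ?thesis using u x a_m[OF x(1)] by metis
qed (simp add: pi_out)

lemma E_pi:
  assumes "u \<in> V" "v \<in> V" "pi u \<noteq> pi v"
  shows "E u v \<longleftrightarrow> E (pi u) (pi v)"
proof -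
  have "E u v \<longleftrightarrow> E u (pi v)" using assms by (rule E_pi_right)
  also have "\<dots> \<longleftrightarrow> E (pi v) u" by (rule E_commute)
  also have "\<dots> \<longleftrightarrow> E (pi v) (pi u)"
    using assms pi_pi pi_in_V' V'_sub by (intro E_pi_right) auto
  finally show ?thesis using E_commute by blast
qed

section \<open>The action of automorphisms on blocks\<close>

lemma aut_block:
  assumes "s \<in> auts V l" "j \<in> J"
  obtains k where "k \<in> J" "\<forall>x\<in>M. s (a j x) \<in> a k ` M"
proof -
  have "s \<circ> a j \<in> auts V l" using assms a_aut comp_in_auts by blast
  then obtain k where k: "k \<in> J" "(s \<circ> a j) ` M = a k ` M" using cover by blast
  with that[of k] show ?thesis by force
qed

lemma aut_in_U:
  assumes "s \<in> auts V l" shows "s v \<in> U \<longleftrightarrow> v \<in> U"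
proof -
  have *: "t v \<in> U" if t: "t \<in> auts V l" and v: "v \<in> U" for t v
  proof -
    from v obtain x where x: "pi v \<in> J" "x \<in> M" "v = a (pi v) x" by (rule U_cases)
    from t x(1) obtain k where "k \<in> J" "\<forall>x\<in>M. t (a (pi v) x) \<in> a k ` M"
      by (rule aut_block)
    then have "t (a (pi v) x) \<in> a k ` M" "k \<in> J" using x(2) by auto
    with x(3) show ?thesis by (auto simp: U_def)
  qed
  show ?thesis
    using *[OF assms] *[OF inv_in_auts[OF assms], of "s v"] auts_inv_left[OF assms] by auto
qed

lemma aut_pi_eq:
  assumes "s \<in> auts V l" "pi u = pi v"
  shows "pi (s u) = pi (s v)"
proof (cases "u \<in> U")
  case True
  then have v: "v \<in> U" using assms(2) pi_in_J by metis
  from True obtain x where x: "pi u \<in> J" "x \<in> M" "u = a (pi u) x" by (rule U_cases)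
  from v obtain y where y: "pi v \<in> J" "y \<in> M" "v = a (pi v) y" by (rule U_cases)
  from assms(1) x(1) obtain k where k: "k \<in> J" "\<forall>x\<in>M. s (a (pi u) x) \<in> a k ` M"
    by (rule aut_block)
  have "s u \<in> a k ` M" "s v \<in> a k ` M" using bspec[OF k(2) x(2)] bspec[OF k(2) y(2)] x(3) y(3) assms(2) by auto
  then show ?thesis using same_block_iff[OF k(1)] by auto
next
  case False
  then have "v \<notin> U" using assms(2) pi_in_J by metis
  then show ?thesis using False assms(2) pi_out by auto
qed

lemma aut_pi_eq_iff:
  assumes "s \<in> auts V l"
  shows "pi (s u) = pi (s v) \<longleftrightarrow> pi u = pi v"
  using aut_pi_eq[OF assms, of u v] aut_pi_eq[OF inv_in_auts[OF assms], of "s u" "s v"]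
  unfolding auts_inv_left[OF assms] by blast

section \<open>Automorphisms of the graph and of its contraction\<close>

lemma aut'_in_J:
  assumes "t \<in> auts V' l'" "v \<in> V'" shows "t v \<in> J \<longleftrightarrow> v \<in> J"
proof -
  \<comment> \<open>The fresh label singles out \<open>J\<close>, so label-preserving maps preserve
    \<open>J\<close>.\<close>
  have "l' v = z \<longleftrightarrow> v \<in> J" if "v \<in> V'" for v
    using fresh that V'_sub by (auto simp: l'_def)
  then show ?thesis using auts_label[OF assms] auts_in[OF assms(1)] assms(2) by metis
qed

text \<open>This is a relation because \<open>q\<close> is free outside \<open>V'\<close> and codes
  determine block colorings only up to automorphism. Composition with \<open>a j\<close> moves the
  coloring of a block to the common copy \<open>M\<close>, so that codes of different blocks are
  comparable.\<close>

definition quot :: "('a \<Rightarrow> nat) \<Rightarrow> ('a \<Rightarrow> nat) \<Rightarrow> bool" where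
  "quot p q \<longleftrightarrow> (\<forall>v\<in>V - U. q v = p v) \<and> (\<forall>j\<in>J. q j = code M l (p \<circ> a j))"

text \<open>If \<open>t\<close> moves block \<open>j\<close> to block \<open>t j\<close>, then the
  colors of both, seen on \<open>M\<close>, have equal codes, hence differ by an automorphism
  \<open>b j\<close> of \<open>M\<close>. These automorphisms are glued along
  \<open>t\<close>.\<close>

lemma lift_aut:
  assumes pq: "quot p q" "quot p' q'" and t: "t \<in> auts V' l'" and qt: "\<And>v. v \<in> V' \<Longrightarrow> q (t v) = q' v"
  obtains s where "s \<in> auts V l" "\<And>v. v \<in> V \<Longrightarrow> p (s v) = p' v" "\<And>v. v \<in> V \<Longrightarrow> pi (s v) = t (pi v)"
proof -
  have JV': "j \<in> V'" if "j \<in> J" for j using that by (auto simp: V'_def)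
  have tJ: "t j \<in> J" if "j \<in> J" for j using aut'_in_J[OF t JV'[OF that]] that by simp
  have "\<forall>j\<in>J. \<exists>b\<in>auts M l. \<forall>x\<in>M. p (a (t j) (b x)) = p' (a j x)"
  proof
    fix j assume j: "j \<in> J"
    have "code M l (p \<circ> a (t j)) = code M l (p' \<circ> a j)"
      using qt[OF JV'[OF j]] pq j tJ[OF j] by (auto simp: quot_def)
    then show "\<exists>b\<in>auts M l. \<forall>x\<in>M. p (a (t j) (b x)) = p' (a j x)"
      unfolding code_eq_iff[OF finM] by auto
  qed
  then obtain b where b: "\<And>j. j \<in> J \<Longrightarrow> b j \<in> auts M l"
    and pb: "\<And>j x. j \<in> J \<Longrightarrow> x \<in> M \<Longrightarrow> p (a (t j) (b j x)) = p' (a j x)" by metis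
  \<comment> \<open>On a block: go back to \<open>M\<close>, correct the colors by \<open>b\<close>,
    go out to the target block.\<close>
  define s where "s v = (if v \<in> U then a (t (pi v)) (b (pi v) (inv (a (pi v)) v))
    else if v \<in> V then t v else v)" for v
  have s_a: "s (a j x) = a (t j) (b j x)" if "j \<in> J" "x \<in> M" for j x
    using that a_in_U auts_inv_left[OF a_aut] by (simp add: s_def)
  have bM: "b j x \<in> M" if "j \<in> J" "x \<in> M" for j x using auts_in[OF b] that by blast
  have s_out: "s v = t v" "t v \<in> V - U" if "v \<in> V - U" for v
  proof -
    show "s v = t v" using that by (simp add: s_def)
    have "v \<in> V'" "v \<notin> J" using that J_sub by (auto simp: V'_def)
    then show "t v \<in> V - U" using aut'_in_J[OF t] auts_in[OF t] unfolding V'_def by blast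
  qed
  have cases: "(v \<in> V - U \<Longrightarrow> Q) \<Longrightarrow> (\<And>j x. j \<in> J \<Longrightarrow> x \<in> M \<Longrightarrow> v = a j x \<Longrightarrow> Q) \<Longrightarrow> Q"
    if "v \<in> V" for v Q using that by (auto simp: U_def)
  have pis: "pi (s v) = t (pi v)" if "v \<in> V" for v
    by (rule cases[OF that]) (use s_out pi_out in \<open>auto simp: s_a bM tJ\<close>)
  have sV: "s v \<in> V" if "v \<in> V" for v
    by (rule cases[OF that]) (use s_out in \<open>auto simp: s_a a_in_V bM tJ\<close>)
  \<comment> \<open>The image block determines the block because \<open>t\<close> is injective;
    within a block, \<open>s\<close> is a composition of injections.\<close>
  have inj: "inj_on s V"
  proof (rule inj_onI)
    fix u v assume uv: "u \<in> V" "v \<in> V" and eq: "s u = s v"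
    then have "t (pi u) = t (pi v)" using pis by metis
    then have pieq: "pi u = pi v" using auts_inj[OF t] by blast
    show "u = v"
    proof (cases "u \<in> U")
      case True
      then have "v \<in> U" using pieq pi_in_J by metis
      obtain x where x: "pi u \<in> J" "x \<in> M" "u = a (pi u) x" using True by (rule U_cases)
      obtain y where y: "pi v \<in> J" "y \<in> M" "v = a (pi v) y" using \<open>v \<in> U\<close> by (rule U_cases)
      have "a (t (pi u)) (b (pi u) x) = a (t (pi u)) (b (pi u) y)"
        using eq s_a[OF x(1,2)] s_a[OF y(1,2)] x(3) y(3) pieq by metis
      then have "x = y" using auts_inj[OF a_aut[OF tJ[OF x(1)]]] auts_inj[OF b[OF x(1)]] by simp
      then show ?thesis using x(3) y(3) pieq by metis
    next
      case False
      then have "v \<notin> U" using pieq pi_in_J by metis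
      then show ?thesis using False pieq pi_out by metis
    qed
  qed
  have "s ` V = V" using sV endo_inj_surj[OF finV _ inj] by blast
  then have "s permutes V" using inj U_sub by (intro bij_imp_permutes) (auto simp: bij_betw_def s_def)
  then have s: "s \<in> auts V l"
  proof (rule autsI)
    fix u v assume uv: "u \<in> V" "v \<in> V"
    show "E (s u) (s v) \<longleftrightarrow> E u v"
    \<comment> \<open>Within a block every factor of \<open>s\<close> preserves adjacency; between
      blocks adjacency can be read off the contraction.\<close>
    proof (cases "pi u = pi v")
      case True
      show ?thesis
      proof (cases "u \<in> U")
        case uU: True
        then have "v \<in> U" using True pi_in_J by metis
        obtain x where x: "pi u \<in> J" "x \<in> M" "u = a (pi u) x" using uU by (rule U_cases)
        obtain y where y: "pi v \<in> J" "y \<in> M" "v = a (pi v) y" using \<open>v \<in> U\<close> by (rule U_cases)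
        define j where "j = pi u"
        have j: "j \<in> J" "u = a j x" "v = a j y" using x y True by (auto simp: j_def)
        have xy: "x \<in> V" "y \<in> V" "b j x \<in> V" "b j y \<in> V" using x(2) y(2) bM[OF j(1)] M_sub by auto
        have "E (s u) (s v) \<longleftrightarrow> E (a (t j) (b j x)) (a (t j) (b j y))"
          using s_a[OF j(1)] x(2) y(2) j by simp
        also have "\<dots> \<longleftrightarrow> E (b j x) (b j y)" using auts_E[OF a_aut[OF tJ[OF j(1)]]] xy by blast
        also have "\<dots> \<longleftrightarrow> E x y" using auts_E[OF b[OF j(1)]] x(2) y(2) by blast
        also have "\<dots> \<longleftrightarrow> E u v" using auts_E[OF a_aut[OF j(1)]] xy j by blast
        finally show ?thesis .
      next
        case False
        then have "v \<notin> U" using True pi_in_J by metis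
        then have "u = v" using False True pi_out by metis
        then show ?thesis using E_irrefl by simp
      qed
    next
      case False
      then have ne: "pi (s u) \<noteq> pi (s v)" using pis uv auts_inj[OF t] by simp
      have "E (s u) (s v) \<longleftrightarrow> E (t (pi u)) (t (pi v))"
        using E_pi[OF sV[OF uv(1)] sV[OF uv(2)] ne] pis uv by simp
      also have "\<dots> \<longleftrightarrow> E (pi u) (pi v)" using auts_E[OF t] pi_in_V' uv by blast
      also have "\<dots> \<longleftrightarrow> E u v" using E_pi[OF uv False] by simp
      finally show ?thesis .
    qed
  next
    fix v assume v: "v \<in> V"
    show "l (s v) = l v"
    proof (rule cases[OF v])
      assume vU: "v \<in> V - U"
      then have v': "v \<in> V'" "v \<notin> J" using J_sub by (auto simp: V'_def)
      then have "t v \<notin> J" using aut'_in_J[OF t] by blast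
      then show ?thesis using auts_label[OF t v'(1)] v'(2) s_out(1)[OF vU] by (simp add: l'_def)
    next
      fix j x assume jx: "j \<in> J" "x \<in> M" "v = a j x"
      have "l (s v) = l (a (t j) (b j x))" using jx s_a by simp
      also have "\<dots> = l (b j x)" using auts_label[OF a_aut[OF tJ[OF jx(1)]]] bM[OF jx(1,2)] M_sub by blast
      also have "\<dots> = l x" using auts_label[OF b[OF jx(1)] jx(2)] .
      also have "\<dots> = l v" using auts_label[OF a_aut[OF jx(1)]] jx M_sub by auto
      finally show ?thesis .
    qed
  qed
  have "p (s v) = p' v" if v: "v \<in> V" for v
  proof (rule cases[OF v])
    assume vU: "v \<in> V - U"
    then have "v \<in> V'" by (auto simp: V'_def)
    then show ?thesis using qt[of v] s_out[OF vU] vU pq by (auto simp: quot_def)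
  next
    fix j x assume "j \<in> J" "x \<in> M" "v = a j x"
    then show ?thesis using pb s_a by simp
  qed
  with s pis that show ?thesis by blast
qed

text \<open>In the coordinates \<open>a j\<close> of the source block and \<open>a k\<close> of the
  target block, \<open>s\<close> becomes \<open>inv (a k) \<circ> s \<circ> a j\<close>, an
  automorphism of \<open>M\<close>.\<close>

lemma block_aut:
  assumes s: "s \<in> auts V l" and j: "j \<in> J"
  obtains b where "b \<in> auts M l" "\<And>x. x \<in> M \<Longrightarrow> s (a j x) = a (pi (s j)) (b x)" "pi (s j) \<in> J"
proof -
  from s j obtain k where k: "k \<in> J" "\<forall>x\<in>M. s (a j x) \<in> a k ` M" by (rule aut_block)
  have kk: "pi (s j) = k" using bspec[OF k(2) mM] same_block_iff[OF k(1)] a_m[OF j] by auto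
  define b where "b x = (if x \<in> M then inv (a k) (s (a j x)) else x)" for x
  have ab: "a k (b x) = s (a j x)" if "x \<in> M" for x
    using that auts_inv_right[OF a_aut[OF k(1)]] by (simp add: b_def)
  have bM: "b x \<in> M" if x: "x \<in> M" for x
    using bspec[OF k(2) x] auts_inv_left[OF a_aut[OF k(1)]] x by (auto simp: b_def)
  have inj: "inj_on b M"
    by (rule inj_onI) (metis ab auts_inj[OF s] auts_inj[OF a_aut[OF j]])
  have "b ` M = M" using bM endo_inj_surj[OF finM _ inj] by blast
  then have "b permutes M" using inj by (intro bij_imp_permutes) (auto simp: bij_betw_def b_def)
  then have "b \<in> auts M l"
  proof (rule autsI)
    fix x y assume xy: "x \<in> M" "y \<in> M"
    then have V: "x \<in> V" "y \<in> V" "b x \<in> V" "b y \<in> V" "a j x \<in> V" "a j y \<in> V"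
      using M_sub bM a_in_V[OF j] by auto
    have "E (b x) (b y) \<longleftrightarrow> E (a k (b x)) (a k (b y))" using auts_E[OF a_aut[OF k(1)]] V by blast
    also have "\<dots> \<longleftrightarrow> E (a j x) (a j y)" using ab xy auts_E[OF s] V by simp
    also have "\<dots> \<longleftrightarrow> E x y" using auts_E[OF a_aut[OF j]] V by blast
    finally show "E (b x) (b y) \<longleftrightarrow> E x y" .
  next
    fix x assume x: "x \<in> M"
    then have V: "x \<in> V" "b x \<in> V" "a j x \<in> V" using M_sub bM a_in_V[OF j] by auto
    show "l (b x) = l x"
      using auts_label[OF a_aut[OF k(1)] V(2)] ab[OF x] auts_label[OF s V(3)]
        auts_label[OF a_aut[OF j] V(1)] by simp
  qed
  with ab that kk k(1) show ?thesis by metis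
qed

text \<open>As \<open>s\<close> permutes the blocks, \<open>pi \<circ> s\<close> permutes their
  representatives, and it agrees with \<open>s\<close> outside the blocks. Between two blocks
  \<open>s\<close> acts as an automorphism of \<open>M\<close>, which leaves the code
  unchanged.\<close>

lemma descend_aut:
  assumes pq: "quot p q" "quot p' q'" and s: "s \<in> auts V l" and ps: "\<And>v. v \<in> V \<Longrightarrow> p (s v) = p' v"
  obtains t where "t \<in> auts V' l'" "\<And>v. v \<in> V' \<Longrightarrow> q (t v) = q' v" "\<And>v. v \<in> V' \<Longrightarrow> t v = pi (s v)"
proof -
  define t where "t v = (if v \<in> V' then pi (s v) else v)" for v
  have t: "t v = pi (s v)" if "v \<in> V'" for v using that by (simp add: t_def)
  have sV: "s v \<in> V" if "v \<in> V'" for v using that V'_sub auts_in[OF s] by blast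
  have tV': "t v \<in> V'" if "v \<in> V'" for v using t[OF that] pi_in_V' sV[OF that] by simp
  have t_inj: "t u = t v \<longleftrightarrow> u = v" if "u \<in> V'" "v \<in> V'" for u v
    using that t aut_pi_eq_iff[OF s] pi_V' by auto
  then have inj: "inj_on t V'" by (auto intro: inj_onI)
  have "t ` V' = V'" using tV' endo_inj_surj[OF finV' _ inj] by blast
  then have "t permutes V'" using inj by (intro bij_imp_permutes) (auto simp: bij_betw_def t_def)
  then have taut: "t \<in> auts V' l'"
  proof (rule autsI)
    fix u v assume uv: "u \<in> V'" "v \<in> V'"
    show "E (t u) (t v) \<longleftrightarrow> E u v"
    proof (cases "u = v")
      case True then show ?thesis using E_irrefl by simp
    next
      case False
      then have "pi (s u) \<noteq> pi (s v)" using t_inj t uv by metis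
      then have "E (t u) (t v) \<longleftrightarrow> E (s u) (s v)" using E_pi sV uv t by auto
      then show ?thesis using auts_E[OF s] uv V'_sub by blast
    qed
  next
    fix v assume v: "v \<in> V'"
    show "l' (t v) = l' v"
    proof (cases "v \<in> J")
      case True
      then have "t v \<in> J" using t[OF v] pi_in_J aut_in_U[OF s] J_sub by auto
      then show ?thesis using True by (simp add: l'_def)
    next
      case False
      then have vU: "v \<notin> U" using v by (auto simp: V'_def)
      then have "s v \<notin> U" using aut_in_U[OF s] by simp
      then have "t v = s v" "t v \<notin> J" using t[OF v] pi_out J_sub by auto
      then show ?thesis using False auts_label[OF s] v V'_sub by (auto simp: l'_def)
    qed
  qed
  have "q (t v) = q' v" if v: "v \<in> V'" for v
  proof (cases "v \<in> J")
    case True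
    from s True obtain b where b: "b \<in> auts M l" "\<And>x. x \<in> M \<Longrightarrow> s (a v x) = a (pi (s v)) (b x)" "pi (s v) \<in> J"
      by (rule block_aut) blast
    have "\<forall>x\<in>M. (p \<circ> a (pi (s v))) (b x) = (p' \<circ> a v) x"
      using b(2) ps a_in_V[OF True] by (metis comp_apply)
    then have "code M l (p \<circ> a (pi (s v))) = code M l (p' \<circ> a v)"
      unfolding code_eq_iff[OF finM] using b(1) by blast
    then show ?thesis using pq True b(3) t[OF v] by (simp add: quot_def)
  next
    case False
    then have vU: "v \<in> V - U" using v by (auto simp: V'_def)
    then have "s v \<in> V - U" using aut_in_U[OF s] auts_in[OF s] by simp
    then show ?thesis using t[OF v] pi_out[of "s v"] vU pq ps[of v] by (simp add: quot_def)
  qed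
  with taut t that show ?thesis by blast
qed

section \<open>Colorings and lists under contraction\<close>

lemma code_quot_iff:
  assumes "quot p q" "quot p' q'"
  shows "code V l p = code V l p' \<longleftrightarrow> code V' l' q = code V' l' q'"
  unfolding code_eq_iff[OF finV] code_eq_iff[OF finV']
proof
  assume "\<exists>s\<in>auts V l. \<forall>v\<in>V. p (s v) = p' v"
  then obtain s where s: "s \<in> auts V l" "\<And>v. v \<in> V \<Longrightarrow> p (s v) = p' v" by blast
  show "\<exists>t\<in>auts V' l'. \<forall>v\<in>V'. q (t v) = q' v"
    by (rule descend_aut[OF assms s]) blast+
next
  assume "\<exists>t\<in>auts V' l'. \<forall>v\<in>V'. q (t v) = q' v"
  then obtain t where t: "t \<in> auts V' l'" "\<And>v. v \<in> V' \<Longrightarrow> q (t v) = q' v" by blast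
  show "\<exists>s\<in>auts V l. \<forall>v\<in>V. p (s v) = p' v"
    by (rule lift_aut[OF assms t]) blast+
qed

text \<open>A color-preserving automorphism of the contraction lifts to a color-preserving one of
  the graph. The lift is trivial, hence so is its action on blocks.\<close>

lemma dist_quot:
  assumes "quot p q" "dist_coloring V l p"
  shows "dist_coloring V' l' q"
  unfolding dist_coloring_def
proof (intro ballI impI)
  fix t v assume t: "t \<in> auts V' l'" "\<forall>v\<in>V'. q (t v) = q v" and v: "v \<in> V'"
  from t(2) have qt: "\<And>v. v \<in> V' \<Longrightarrow> q (t v) = q v" by blast
  obtain s where s: "s \<in> auts V l" "\<And>v. v \<in> V \<Longrightarrow> p (s v) = p v" "\<And>v. v \<in> V \<Longrightarrow> pi (s v) = t (pi v)"
    using lift_aut[OF assms(1) assms(1) t(1) qt] by blast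
  have "s v = v" using assms(2) s(1,2) v V'_sub by (auto simp: dist_coloring_def)
  then show "t v = v" using s(3)[of v] v V'_sub pi_V' by auto
qed

text \<open>Conjugation by \<open>a j\<close> turns a color-preserving automorphism of
  \<open>M\<close> into one of the whole graph supported on the block of \<open>j\<close>.\<close>

lemma dist_block:
  assumes "dist_coloring V l p" "j \<in> J"
  shows "dist_coloring M l (p \<circ> a j)"
  unfolding dist_coloring_def
proof (intro ballI impI)
  fix b x assume b: "b \<in> auts M l" "\<forall>x\<in>M. (p \<circ> a j) (b x) = (p \<circ> a j) x" and x: "x \<in> M"
  have a: "a j \<in> auts V l" using a_aut assms(2) .
  have bV: "b \<in> auts V l" using b(1) auts_module_subset[OF modM] by blast
  have "a j \<circ> b \<circ> inv (a j) \<in> auts V l" using a bV by (intro comp_in_auts inv_in_auts)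
  moreover have "p ((a j \<circ> b \<circ> inv (a j)) v) = p v" if "v \<in> V" for v
  proof (cases "inv (a j) v \<in> M")
    case True
    then show ?thesis using b(2) auts_inv_right[OF a] by auto
  next
    case False
    then have "b (inv (a j) v) = inv (a j) v" using auts_permutes[OF b(1)] by (simp add: permutes_def)
    then show ?thesis using auts_inv_right[OF a] by simp
  qed
  ultimately have "(a j \<circ> b \<circ> inv (a j)) (a j x) = a j x"
    using assms(1) a_in_V[OF assms(2) x] unfolding dist_coloring_def by blast
  then show "b x = x" using auts_inv_left[OF a] auts_inj[OF a] by simp
qed

text \<open>A color-preserving automorphism descends to a trivial one, so it maps every block to
  itself. On each block it is a color-preserving automorphism of \<open>M\<close>, hence
  trivial.\<close>

lemma dist_of_quot:
  assumes "quot p q" "dist_coloring V' l' q" "\<And>j. j \<in> J \<Longrightarrow> dist_coloring M l (p \<circ> a j)"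
  shows "dist_coloring V l p"
  unfolding dist_coloring_def
proof (intro ballI impI)
  fix s v assume s: "s \<in> auts V l" "\<forall>v\<in>V. p (s v) = p v" and v: "v \<in> V"
  from s(2) have ps: "\<And>v. v \<in> V \<Longrightarrow> p (s v) = p v" by blast
  obtain t where t: "t \<in> auts V' l'" "\<And>v. v \<in> V' \<Longrightarrow> q (t v) = q v" "\<And>v. v \<in> V' \<Longrightarrow> t v = pi (s v)"
    using descend_aut[OF assms(1) assms(1) s(1) ps] by blast
  have fixed: "pi (s v) = v" if "v \<in> V'" for v
    using assms(2) t that by (auto simp: dist_coloring_def)
  show "s v = v"
  proof (cases "v \<in> U")
    case True
    then obtain x where x: "pi v \<in> J" "x \<in> M" "v = a (pi v) x" by (rule U_cases)
    from s(1) x(1) obtain b where b: "b \<in> auts M l"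
      "\<And>x. x \<in> M \<Longrightarrow> s (a (pi v) x) = a (pi (s (pi v))) (b x)" by (rule block_aut) blast
    have "pi (s (pi v)) = pi v" using fixed[of "pi v"] pi_in_V'[OF v] by simp
    then have sb: "s (a (pi v) x) = a (pi v) (b x)" if "x \<in> M" for x using b(2)[OF that] by simp
    have "\<forall>x\<in>M. (p \<circ> a (pi v)) (b x) = (p \<circ> a (pi v)) x"
      using sb ps a_in_V[OF x(1)] by (metis comp_apply)
    then have "b x = x" using assms(3)[OF x(1)] b(1) x(2) unfolding dist_coloring_def by blast
    then show ?thesis using sb[OF x(2)] x(3) by simp
  next
    case False
    then have "v \<in> V'" using v by (simp add: V'_def)
    moreover have "s v \<notin> U" using False aut_in_U[OF s(1)] by simp
    ultimately show ?thesis using fixed[of v] pi_out[of "s v"] by simp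
  qed
qed

definition quot_list :: "('a \<Rightarrow> nat set) \<Rightarrow> 'a \<Rightarrow> nat set" where
  "quot_list L v = (if v \<in> J then code M l ` dist_L_colorings M l (L \<circ> a v) else L v)"

lemma num_classes_quot: "num_classes V l L = num_classes V' l' (quot_list L)"
  unfolding num_classes_def
proof (rule card_image_eq_of_correspondence[where R = quot])
  fix p assume p: "p \<in> dist_L_colorings V l L"
  define q where "q v = (if v \<in> J then code M l (p \<circ> a v) else p v)" for v
  have pq: "quot p q" using J_sub unfolding quot_def q_def by auto
  have "q v \<in> quot_list L v" if v: "v \<in> V'" for v
  proof (cases "v \<in> J")
    case True
    have "p \<circ> a v \<in> dist_L_colorings M l (L \<circ> a v)"
      using p dist_block[OF _ True] a_in_V[OF True] by (auto simp: dist_L_colorings_def)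
    then show ?thesis using True by (simp add: q_def quot_list_def)
  next
    case False
    have "p v \<in> L v" using p v V'_sub by (auto simp: dist_L_colorings_def)
    then show ?thesis using False by (simp add: q_def quot_list_def)
  qed
  then have "q \<in> dist_L_colorings V' l' (quot_list L)"
    using p dist_quot[OF pq] by (auto simp: dist_L_colorings_def)
  with pq show "\<exists>q\<in>dist_L_colorings V' l' (quot_list L). quot p q" by blast
next
  fix q assume q: "q \<in> dist_L_colorings V' l' (quot_list L)"
  \<comment> \<open>Every color \<open>q j\<close> is the code of a coloring of \<open>M\<close>; a
    representative, carried to the block of \<open>j\<close>, defines \<open>p\<close>
    there.\<close>
  have "\<forall>j\<in>J. \<exists>c. c \<in> dist_L_colorings M l (L \<circ> a j) \<and> code M l c = q j"
  proof
    fix j assume j: "j \<in> J"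
    then have "q j \<in> quot_list L j" using q by (auto simp: dist_L_colorings_def V'_def)
    then show "\<exists>c. c \<in> dist_L_colorings M l (L \<circ> a j) \<and> code M l c = q j"
      using j by (auto simp: quot_list_def)
  qed
  then obtain c where c: "\<And>j. j \<in> J \<Longrightarrow> c j \<in> dist_L_colorings M l (L \<circ> a j)"
    "\<And>j. j \<in> J \<Longrightarrow> code M l (c j) = q j" by metis
  define p where "p v = (if v \<in> U then c (pi v) (inv (a (pi v)) v) else q v)" for v
  have pa: "p (a j x) = c j x" if "j \<in> J" "x \<in> M" for j x
    using that a_in_U auts_inv_left[OF a_aut] by (simp add: p_def)
  have "code M l (p \<circ> a j) = q j" if j: "j \<in> J" for j
    using c(2)[OF j] code_cong[OF finM, of "p \<circ> a j" "c j"] pa[OF j] by auto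
  then have pq: "quot p q" by (auto simp: quot_def p_def)
  have "dist_coloring M l (p \<circ> a j)" if j: "j \<in> J" for j
    using c(1)[OF j] dist_coloring_cong[of M "p \<circ> a j" "c j"] pa[OF j] by (auto simp: dist_L_colorings_def)
  then have "dist_coloring V l p" using dist_of_quot[OF pq] q by (auto simp: dist_L_colorings_def)
  moreover have "p v \<in> L v" if v: "v \<in> V" for v
  proof (cases "v \<in> U")
    case True
    then obtain x where x: "pi v \<in> J" "x \<in> M" "v = a (pi v) x" by (rule U_cases)
    have "c (pi v) x \<in> L (a (pi v) x)" using c(1)[OF x(1)] x(2) by (auto simp: dist_L_colorings_def)
    then show ?thesis using pa[OF x(1,2)] x(3) by metis
  next
    case False
    then have "v \<in> V'" "v \<notin> J" using v J_sub by (auto simp: V'_def)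
    then show ?thesis using q False by (auto simp: p_def dist_L_colorings_def quot_list_def)
  qed
  ultimately have "p \<in> dist_L_colorings V l L" by (simp add: dist_L_colorings_def)
  with pq show "\<exists>p\<in>dist_L_colorings V l L. quot p q" by blast
next
  fix p q p' q' assume "quot p q" "quot p' q'"
  then show "code V l p = code V l p' \<longleftrightarrow> code V' l' q = code V' l' q'"
    by (rule code_quot_iff)
qed

text \<open>Extend \<open>F\<close> to the fresh label \<open>z\<close> by the set \<open>N\<close>
  of classes of \<open>M\<close>. Goodness of \<open>M\<close> says that every contracted vertex has
  a list at least as large as \<open>N\<close>, so goodness of \<open>V'\<close> applies;
  contraction preserves both numbers of classes.\<close>

lemma list_good_of_quot:
  assumes M: "list_good M l" and V': "list_good V' l'"
  shows "list_good V l"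
  unfolding list_good_def
proof (intro allI impI)
  fix F :: "nat \<Rightarrow> nat set" and L :: "'a \<Rightarrow> nat set"
  assume F: "\<forall>i. finite (F i)" and L: "\<forall>v\<in>V. finite (L v) \<and> card (F (l v)) \<le> card (L v)"
  define N where "N = code M l ` dist_L_colorings M l (\<lambda>v. F (l v))"
  define F' where "F' = F(z := N)"
  have finN: "finite N" unfolding N_def by (rule finite_code_image[OF finM]) (use F in auto)
  \<comment> \<open>Since labels are preserved, the reference lists look the same in all blocks, and
    one list at \<open>z\<close> serves all of \<open>J\<close>.\<close>
  have la: "l (a j x) = l x" if "j \<in> J" "x \<in> M" for j x
    using auts_label[OF a_aut[OF that(1)]] that(2) M_sub by blast
  have q: "quot_list (\<lambda>v. F (l v)) v = F' (l' v)" if v: "v \<in> V'" for v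
  proof (cases "v \<in> J")
    case True
    have "dist_L_colorings M l ((\<lambda>v. F (l v)) \<circ> a v) = dist_L_colorings M l (\<lambda>v. F (l v))"
      using la[OF True] by (auto simp: dist_L_colorings_def)
    then show ?thesis using True by (simp add: quot_list_def F'_def l'_def N_def)
  next
    case False
    then show ?thesis using v V'_sub fresh by (auto simp: quot_list_def F'_def l'_def)
  qed
  have dq: "dist_L_colorings V' l' (quot_list (\<lambda>v. F (l v))) = dist_L_colorings V' l' (\<lambda>v. F' (l' v))"
    using q by (auto simp: dist_L_colorings_def)
  have "num_classes V l (\<lambda>v. F (l v)) = num_classes V' l' (\<lambda>v. F' (l' v))"
    unfolding num_classes_quot unfolding num_classes_def dq ..
  also have "\<dots> \<le> num_classes V' l' (quot_list L)"
  proof -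
    have "\<forall>i. finite (F' i)" using F finN by (simp add: F'_def)
    moreover have "finite (quot_list L v) \<and> card (F' (l' v)) \<le> card (quot_list L v)" if v: "v \<in> V'" for v
    proof (cases "v \<in> J")
      case True
      have La: "\<forall>x\<in>M. finite ((L \<circ> a v) x) \<and> card (F (l x)) \<le> card ((L \<circ> a v) x)"
        using L a_in_V[OF True] la[OF True] by force
      then have "num_classes M l (\<lambda>v. F (l v)) \<le> num_classes M l (L \<circ> a v)"
        using M F unfolding list_good_def by blast
      moreover have "finite (quot_list L v)"
        using True La finite_code_image[OF finM] by (simp add: quot_list_def)
      ultimately show ?thesis using True by (simp add: quot_list_def F'_def l'_def N_def num_classes_def)
    next
      case False
      then show ?thesis using L v V'_sub fresh by (auto simp: quot_list_def F'_def l'_def)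
    qed
    ultimately show ?thesis using V' unfolding list_good_def by blast
  qed
  also have "\<dots> = num_classes V l L" unfolding num_classes_quot ..
  finally show "num_classes V l (\<lambda>v. F (l v)) \<le> num_classes V l L" .
qed

text \<open>A vertex of a block that comes from some \<open>x \<noteq> m\<close> is not a
  representative, so it disappears.\<close>

lemma card_V'_less:
  assumes "card M \<ge> 2" shows "card V' < card V"
proof -
  have "\<not> card M \<le> Suc 0" using assms by simp
  then have "\<exists>x\<in>M. \<exists>y\<in>M. x \<noteq> y" using card_le_Suc0_iff_eq[OF finM] by blast
  then obtain x where x: "x \<in> M" "x \<noteq> m" by metis
  obtain j where j: "j \<in> J" using cover[OF id_in_auts] by blast
  have "a j x \<noteq> j" using auts_inj[OF a_aut[OF j], of x m] a_m[OF j] x(2) by simp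
  then have "a j x \<notin> J" using pi_J[of "a j x"] pi_a[OF j x(1)] by auto
  then have "a j x \<notin> V'" using a_in_U[OF j x(1)] by (simp add: V'_def)
  then have "V' \<subset> V" using V'_sub a_in_V[OF j x(1)] by blast
  then show ?thesis using finV psubset_card_mono by blast
qed

end

section \<open>Small automorphism groups and full symmetric groups\<close>

text \<open>Vertices are colored one by one. At a new vertex the used colors exclude exactly
  \<open>card V\<close> elements of \<open>A\<close>, but at most that many from any other list of
  the same size.\<close>

lemma card_inj_PiE_const_le:
  assumes "finite V" "finite A" "\<And>v. v \<in> V \<Longrightarrow> finite (L v) \<and> card (L v) = card A"
  shows "card {p \<in> V \<rightarrow>\<^sub>E A. inj_on p V} \<le> card {p \<in> PiE V L. inj_on p V}"
  using assms(1,3)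
proof (induction V rule: finite_induct)
  case (insert x V)
  define S where "S = {p \<in> V \<rightarrow>\<^sub>E A. inj_on p V}"
  define T where "T = {p \<in> PiE V L. inj_on p V}"
  have "finite (V \<rightarrow>\<^sub>E A)" "finite (PiE V L)"
    using insert.hyps(1) insert.prems assms(2) by (auto intro!: finite_PiE)
  then have fin: "finite S" "finite T" by (simp_all add: S_def T_def)
  have "card {p \<in> insert x V \<rightarrow>\<^sub>E A. inj_on p (insert x V)} \<le> card (SIGMA p:S. A - p ` V)"
  proof (rule card_inj_on_le)
    let ?f = "\<lambda>p. (p(x := undefined), p x)"
    show "inj_on ?f {p \<in> insert x V \<rightarrow>\<^sub>E A. inj_on p (insert x V)}"
      by (rule inj_onI) (metis Pair_inject fun_upd_triv fun_upd_upd)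
    show "?f ` {p \<in> insert x V \<rightarrow>\<^sub>E A. inj_on p (insert x V)} \<subseteq> (SIGMA p:S. A - p ` V)"
    proof
      fix y assume "y \<in> ?f ` {p \<in> insert x V \<rightarrow>\<^sub>E A. inj_on p (insert x V)}"
      then obtain p where p: "y = ?f p" "p \<in> insert x V \<rightarrow>\<^sub>E A" "inj_on p (insert x V)" by blast
      have eq: "(p(x := undefined)) v = p v" if "v \<in> V" for v using that insert.hyps(2) by auto
      have "inj_on (p(x := undefined)) V"
        using p(3) inj_on_cong[of V "p(x := undefined)" p] eq by (auto simp: inj_on_insert)
      moreover have "p(x := undefined) \<in> V \<rightarrow>\<^sub>E A"
        using p(2) eq by (auto simp: PiE_iff extensional_def)
      moreover have "p x \<in> A - p(x := undefined) ` V"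
        using p(2,3) eq insert.hyps(2) by (auto simp: PiE_iff inj_on_def)
      ultimately show "y \<in> (SIGMA p:S. A - p ` V)" unfolding p(1) S_def by blast
    qed
    show "finite (SIGMA p:S. A - p ` V)" using fin assms(2) by auto
  qed
  also have "\<dots> = card S * (card A - card V)"
  proof -
    have "card (A - p ` V) = card A - card V" if "p \<in> S" for p
    proof -
      have "p ` V \<subseteq> A" "inj_on p V" using that by (auto simp: S_def)
      then show ?thesis using card_Diff_subset[of "p ` V" A] insert.hyps(1) by (simp add: card_image)
    qed
    then show ?thesis using fin assms(2) by (simp add: card_SigmaI)
  qed
  also have "\<dots> \<le> card T * (card A - card V)"
    using insert.IH insert.prems unfolding S_def T_def by (intro mult_right_mono) auto
  also have "\<dots> \<le> card (SIGMA p:T. L x - p ` V)"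
  proof -
    have "card A - card V \<le> card (L x - p ` V)" if "p \<in> T" for p
    proof -
      have "card A - card (p ` V) \<le> card (L x - p ` V)"
        using diff_card_le_card_Diff[of "p ` V" "L x"] insert.hyps(1) insert.prems[of x] by simp
      then show ?thesis using that by (simp add: T_def card_image)
    qed
    then have "(\<Sum>p\<in>T. card A - card V) \<le> (\<Sum>p\<in>T. card (L x - p ` V))" by (rule sum_mono)
    then show ?thesis using fin insert.prems[of x] by (simp add: card_SigmaI)
  qed
  also have "\<dots> \<le> card {p \<in> PiE (insert x V) L. inj_on p (insert x V)}"
  proof (rule card_inj_on_le)
    let ?f = "\<lambda>(p, c). p(x := c)"
    have ext: "p x = undefined" if "p \<in> T" for p
      using that insert.hyps(2) by (auto simp: T_def PiE_def extensional_def)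
    show "inj_on ?f (SIGMA p:T. L x - p ` V)"
    proof (rule inj_onI, clarify)
      fix p c q d assume pq: "p \<in> T" "q \<in> T" and eq: "p(x := c) = q(x := d)"
      have "p v = q v" for v using fun_cong[OF eq, of v] ext[OF pq(1)] ext[OF pq(2)] by (cases "v = x") auto
      moreover have "c = d" using fun_cong[OF eq, of x] by simp
      ultimately show "p = q \<and> c = d" by auto
    qed
    show "?f ` (SIGMA p:T. L x - p ` V) \<subseteq> {p \<in> PiE (insert x V) L. inj_on p (insert x V)}"
    proof clarify
      fix p c assume p: "p \<in> T" and c: "c \<in> L x" "c \<notin> p ` V"
      have eq: "(p(x := c)) v = p v" if "v \<in> V" for v using that insert.hyps(2) by auto
      have "p(x := c) \<in> PiE (insert x V) L"
        using p c(1) by (auto simp: T_def PiE_iff extensional_def)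
      moreover have "inj_on (p(x := c)) (insert x V)"
        using p c(2) eq insert.hyps(2) by (auto simp: T_def inj_on_def)
      ultimately show "p(x := c) \<in> PiE (insert x V) L \<and> inj_on (p(x := c)) (insert x V)" ..
    qed
    show "finite {p \<in> PiE (insert x V) L. inj_on p (insert x V)}"
      using finite_PiE[of "insert x V" L] insert.hyps(1) insert.prems by auto
  qed
  finally show ?case .
qed auto

context simple_graph_relation
begin

text \<open>Transpositions are automorphisms, so the distinguishing colorings are the injective ones
  and all labels agree. The reference lists are then one constant set.\<close>

lemma list_good_full_symmetric:
  assumes V: "finite V" and auts: "\<And>s. s permutes V \<Longrightarrow> s \<in> auts V l"
  shows "list_good V l"
proof (rule list_goodI_card[OF V])
  have dist: "dist_coloring V l p \<longleftrightarrow> inj_on p V" for p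
  proof
    assume d: "dist_coloring V l p"
    show "inj_on p V"
    proof (rule inj_onI)
      fix u v assume uv: "u \<in> V" "v \<in> V" "p u = p v"
      have "Transposition.transpose u v \<in> auts V l" using auts permutes_swap_id uv by metis
      moreover have "\<forall>w\<in>V. p (Transposition.transpose u v w) = p w" using uv by (auto simp: Transposition.transpose_def)
      ultimately have "Transposition.transpose u v u = u" using d uv(1) unfolding dist_coloring_def by blast
      then show "u = v" by simp
    qed
  next
    assume "inj_on p V"
    then show "dist_coloring V l p"
      unfolding dist_coloring_def by (auto simp: auts_in inj_on_eq_iff)
  qed
  fix F :: "nat \<Rightarrow> nat set" and L :: "'a \<Rightarrow> nat set"
  assume F: "\<And>i. finite (F i)" and L: "\<And>v. v \<in> V \<Longrightarrow> finite (L v) \<and> card (L v) = card (F (l v))"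
  have l: "l u = l v" if "u \<in> V" "v \<in> V" for u v
    using auts_label[OF auts[OF permutes_swap_id[OF that]] that(1)] by simp
  show "card {p \<in> (\<Pi>\<^sub>E v\<in>V. F (l v)). dist_coloring V l p} \<le> card {p \<in> PiE V L. dist_coloring V l p}"
  \<comment> \<open>A vertex is needed to name the common label.\<close>
  proof (cases "V = {}")
    case False
    then obtain w where w: "w \<in> V" by blast
    have "(\<Pi>\<^sub>E v\<in>V. F (l v)) = (V \<rightarrow>\<^sub>E F (l w))" using l w by (intro PiE_cong) metis
    moreover have "finite (L v) \<and> card (L v) = card (F (l w))" if "v \<in> V" for v using L l w that by metis
    ultimately show ?thesis unfolding dist using card_inj_PiE_const_le[OF V F[of "l w"], of L] by simp
  qed simp
qed

lemma list_good_trivial_auts: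
  assumes V: "finite V" and auts: "auts V l = {id}"
  shows "list_good V l"
proof (rule list_goodI_card[OF V])
  have dist: "dist_coloring V l p" for p by (simp add: dist_coloring_def auts)
  fix F :: "nat \<Rightarrow> nat set" and L :: "'a \<Rightarrow> nat set"
  assume "\<And>v. v \<in> V \<Longrightarrow> finite (L v) \<and> card (L v) = card (F (l v))"
  then show "card {p \<in> (\<Pi>\<^sub>E v\<in>V. F (l v)). dist_coloring V l p} \<le> card {p \<in> PiE V L. dist_coloring V l p}"
    using V by (simp add: dist card_PiE)
qed

text \<open>\<open>t\<close> is an involution, and exactly the \<open>t\<close>-invariant colorings
  fail to be distinguishing. Both products have the same size, so it suffices that the lists
  \<open>L\<close> admit at most as many invariant colorings as the reference lists.\<close>

lemma list_good_card_auts_2: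
  assumes V: "finite V" and auts: "auts V l = {id, t}"
  shows "list_good V l"
proof (cases "t = id")
  case True
  then show ?thesis using list_good_trivial_auts[OF V] auts by simp
next
  case t: False
  have tA: "t \<in> auts V l" using auts by simp
  have "t \<circ> t \<in> {id, t}" using comp_in_auts[OF tA tA] auts by simp
  moreover have "t \<circ> t \<noteq> t" using t auts_inj[OF tA] by (metis comp_apply eq_id_iff ext)
  ultimately have tt: "t (t v) = v" for v by (auto simp: fun_eq_iff)
  define I where "I L = {p \<in> PiE V L. \<forall>v\<in>V. p (t v) = p v}" for L :: "'a \<Rightarrow> nat set"
  have "\<exists>v\<in>V. t v \<noteq> v" using t auts_eq_idI[OF tA] by blast
  then have dist: "dist_coloring V l p \<longleftrightarrow> \<not> (\<forall>v\<in>V. p (t v) = p v)" for p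
    by (auto simp: dist_coloring_def auts)
  have D: "{p \<in> PiE V L. dist_coloring V l p} = PiE V L - I L" for L
    by (auto simp: dist I_def)
  show ?thesis
  proof (rule list_goodI_card[OF V])
    fix F :: "nat \<Rightarrow> nat set" and L :: "'a \<Rightarrow> nat set"
    assume F: "\<And>i. finite (F i)" and L: "\<And>v. v \<in> V \<Longrightarrow> finite (L v) \<and> card (L v) = card (F (l v))"
    let ?F = "\<lambda>v. F (l v)"
    have fin: "finite (PiE V L)" "finite (PiE V ?F)" using V L F by (auto intro!: finite_PiE)
    have "\<forall>v\<in>V. \<exists>h. bij_betw h (L v) (F (l v))" using L F finite_same_card_bij by metis
    then obtain h where h: "\<And>v. v \<in> V \<Longrightarrow> bij_betw (h v) (L v) (F (l v))" by metis
    \<comment> \<open>The choice depends only on the set \<open>{v, t v}\<close>, so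
      \<open>r\<close> picks one representative per orbit.\<close>
    define r where "r v = (SOME x. x \<in> {v, t v})" for v
    have r: "r v \<in> {v, t v}" for v unfolding r_def by (rule someI[of _ v]) simp
    have rt: "r (t v) = r v" for v unfolding r_def tt by (simp add: insert_commute)
    have rV: "r v \<in> V" "l (r v) = l v" if "v \<in> V" for v
      using r[of v] that auts_in[OF tA] auts_label[OF tA] by auto
    have pr: "p (r v) = p v" if "p \<in> I L" "v \<in> V" for p v
      using r[of v] that by (auto simp: I_def)
    have pL: "p v \<in> L (r v)" if "p \<in> I L" "v \<in> V" for p v
      using pr[OF that] that(1) rV(1)[OF that(2)] by (auto simp: I_def PiE_iff)
    \<comment> \<open>The common color of an orbit lies in the list of its representative, and
      \<open>h\<close> maps that list bijectively onto the reference list of the whole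
      orbit.\<close>
    have "card (I L) \<le> card (I ?F)"
    proof (rule card_inj_on_le)
      let ?g = "\<lambda>p. restrict (\<lambda>v. h (r v) (p v)) V"
      show "inj_on ?g (I L)"
      proof (rule inj_onI)
        fix p q assume pq: "p \<in> I L" "q \<in> I L" and eq: "?g p = ?g q"
        have "p v = q v" if v: "v \<in> V" for v
        proof -
          have "h (r v) (p v) = h (r v) (q v)" using fun_cong[OF eq, of v] v by simp
          then show ?thesis using h[OF rV(1)[OF v]] pL pq v by (auto simp: bij_betw_def inj_on_eq_iff)
        qed
        then show "p = q" using pq by (auto simp: I_def intro: PiE_ext)
      qed
      show "?g ` I L \<subseteq> I ?F"
      proof
        fix y assume "y \<in> ?g ` I L"
        then obtain p where p: "p \<in> I L" and y: "y = ?g p" by blast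
        have "h (r v) (p v) \<in> F (l v)" if v: "v \<in> V" for v
          using h[OF rV(1)[OF v]] pL[OF p v] rV(2)[OF v] by (auto simp: bij_betw_def)
        then have "y \<in> PiE V ?F" unfolding y by auto
        moreover have "y (t v) = y v" if "v \<in> V" for v
          using that p auts_in[OF tA, of v] by (simp add: y rt I_def)
        ultimately show "y \<in> I ?F" by (simp add: I_def)
      qed
      show "finite (I ?F)" using fin by (simp add: I_def)
    qed
    moreover have "card (PiE V ?F) = card (PiE V L)" using V L by (simp add: card_PiE)
    moreover have "finite (I L)" "finite (I ?F)" "I L \<subseteq> PiE V L" "I ?F \<subseteq> PiE V ?F"
      using fin by (auto simp: I_def)
    ultimately show "card {p \<in> PiE V ?F. dist_coloring V l p} \<le> card {p \<in> PiE V L. dist_coloring V l p}"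
      unfolding D by (simp add: card_Diff_subset)
  qed
qed

end

section \<open>Gallai colorings\<close>

definition color_rel :: "('a \<Rightarrow> 'a \<Rightarrow> 'c) \<Rightarrow> 'c \<Rightarrow> 'a set \<Rightarrow> ('a \<times> 'a) set" where
  "color_rel c a V = {(u, v). u \<in> V \<and> v \<in> V \<and> u \<noteq> v \<and> c u v = a}"

definition color_component :: "('a \<Rightarrow> 'a \<Rightarrow> 'c) \<Rightarrow> 'c \<Rightarrow> 'a set \<Rightarrow> 'a \<Rightarrow> 'a set" where
  "color_component c a V x = (color_rel c a V)\<^sup>* `` {x}"

definition color_connected :: "('a \<Rightarrow> 'a \<Rightarrow> 'c) \<Rightarrow> 'c \<Rightarrow> 'a set \<Rightarrow> bool" where
  "color_connected c a V \<longleftrightarrow> (\<forall>x\<in>V. color_component c a V x = V)"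

lemma color_component_refl: "x \<in> color_component c a V x"
  by (simp add: color_component_def)

lemma color_component_subset:
  assumes "x \<in> V" shows "color_component c a V x \<subseteq> V"
proof
  fix y assume "y \<in> color_component c a V x"
  then have "(x, y) \<in> (color_rel c a V)\<^sup>*" by (simp add: color_component_def)
  then show "y \<in> V" using assms by (induction rule: rtrancl_induct) (auto simp: color_rel_def)
qed

lemma color_component_step:
  assumes "y \<in> color_component c a V x" "y \<in> V" "v \<in> V" "y \<noteq> v" "c y v = a"
  shows "v \<in> color_component c a V x"
proof -
  have "(x, y) \<in> (color_rel c a V)\<^sup>*" using assms(1) by (simp add: color_component_def)
  moreover have "(y, v) \<in> color_rel c a V" using assms by (simp add: color_rel_def)
  ultimately show ?thesis unfolding color_component_def by (simp add: rtrancl_into_rtrancl)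
qed

lemma color_component_eq:
  assumes sym: "\<And>u v. c u v = c v u" and y: "y \<in> color_component c a V x"
  shows "color_component c a V y = color_component c a V x"
proof -
  have "sym (color_rel c a V)" using sym by (auto simp: sym_def color_rel_def)
  then have "sym ((color_rel c a V)\<^sup>*)" by (rule sym_rtrancl)
  moreover have xy: "(x, y) \<in> (color_rel c a V)\<^sup>*" using y by (simp add: color_component_def)
  ultimately have "(y, x) \<in> (color_rel c a V)\<^sup>*" by (rule symD)
  with xy show ?thesis unfolding color_component_def by (auto intro: rtrancl_trans)
qed

lemma color_connected_cut:
  assumes "color_connected c a V" "X \<subseteq> V" "X \<noteq> {}" "X \<noteq> V"
  obtains x y where "x \<in> X" "y \<in> V - X" "c x y = a"
proof -
  obtain x y where xy: "x \<in> X" "y \<in> V - X" using assms by blast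
  have "x \<in> V" using xy(1) assms(2) by blast
  then have "y \<in> color_component c a V x" using assms(1) xy by (simp add: color_connected_def)
  then have "(x, y) \<in> (color_rel c a V)\<^sup>*" by (simp add: color_component_def)
  then have "y \<notin> X \<longrightarrow> (\<exists>x\<in>X. \<exists>y\<in>V - X. c x y = a)"
    by (induction rule: rtrancl_induct) (use xy(1) in \<open>auto simp: color_rel_def\<close>)
  with xy that show ?thesis by blast
qed

definition gallai_coloring :: "('a \<Rightarrow> 'a \<Rightarrow> 'c) \<Rightarrow> 'a set \<Rightarrow> bool" where
  "gallai_coloring c V \<longleftrightarrow> (\<forall>u v. c u v = c v u) \<and>
     (\<forall>x\<in>V. \<forall>y\<in>V. \<forall>z\<in>V. x \<noteq> y \<longrightarrow> y \<noteq> z \<longrightarrow> x \<noteq> z \<longrightarrow>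
        c x y = c y z \<or> c y z = c x z \<or> c x y = c x z)"

lemma gallai_coloring_subset: "gallai_coloring c V \<Longrightarrow> W \<subseteq> V \<Longrightarrow> gallai_coloring c W"
  unfolding gallai_coloring_def by blast

lemma gallai_sym: "gallai_coloring c V \<Longrightarrow> c u v = c v u"
  unfolding gallai_coloring_def by blast

lemma color_component_no_edge:
  assumes g: "gallai_coloring c V" and "x \<in> V" "v \<in> V" "v \<notin> color_component c a V x"
    "y \<in> color_component c a V x"
  shows "c v y \<noteq> a"
proof
  assume "c v y = a"
  then have "c y v = a" using gallai_sym[OF g] by metis
  moreover have "y \<in> V" using color_component_subset[OF assms(2), of c a] assms(5) by blast
  ultimately show False using color_component_step[OF assms(5) _ assms(3)] assms(4,5) by metis
qed

text \<open>Along an \<open>a\<close>-edge \<open>y w\<close> of the component, neither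
  \<open>c v y\<close> nor \<open>c v w\<close> is \<open>a\<close>; as the triangle is not rainbow,
  they agree.\<close>

lemma color_component_homogeneous:
  assumes g: "gallai_coloring c V" and x: "x \<in> V" and v: "v \<in> V" "v \<notin> color_component c a V x"
    and y: "y \<in> color_component c a V x"
  shows "c v y = c v x"
proof -
  have "(x, y) \<in> (color_rel c a V)\<^sup>*" using y by (simp add: color_component_def)
  then show ?thesis
  proof (induction rule: rtrancl_induct)
    case (step y w)
    have yC: "y \<in> color_component c a V x" using step.hyps(1) by (simp add: color_component_def)
    have wC: "w \<in> color_component c a V x" using step.hyps by (auto simp: color_component_def)
    have yw: "y \<in> V" "w \<in> V" "y \<noteq> w" "c y w = a" using step.hyps(2) by (auto simp: color_rel_def)
    have "c v y \<noteq> a" "c v w \<noteq> a" using color_component_no_edge[OF g x v] yC wC by auto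
    moreover have "v \<noteq> y" "v \<noteq> w" using yC wC v(2) by auto
    ultimately have "c v y = c v w"
      using g v(1) yw unfolding gallai_coloring_def by metis
    then show ?case using step.IH by simp
  qed simp
qed

text \<open>The vertex \<open>v\<close> alone links the \<open>a\<close>-components of
  \<open>W\<close>, and it also has neighbors \<open>x\<close> and \<open>y\<close> in colors
  \<open>b\<close> and \<open>d\<close>. Triangles through \<open>v\<close> and homogeneity force
  both \<open>b\<close> and \<open>d\<close> on one edge between two components.\<close>

lemma gallai_three_connected_step:
  assumes g: "gallai_coloring c (insert v W)" and v: "v \<notin> W" and W: "W \<noteq> {}"
    and col: "\<And>x y. x \<in> insert v W \<Longrightarrow> y \<in> insert v W \<Longrightarrow> x \<noteq> y \<Longrightarrow> c x y \<in> {a, b, d}"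
    and abd: "a \<noteq> b" "a \<noteq> d" "b \<noteq> d"
    and con: "color_connected c a (insert v W)" "color_connected c b (insert v W)"
      "color_connected c d (insert v W)"
    and not: "\<not> color_connected c a W"
  shows False
proof -
  have sym: "\<And>u v. c u v = c v u" by (rule gallai_sym[OF g])
  have gW: "gallai_coloring c W" using g by (rule gallai_coloring_subset) auto
  let ?C = "color_component c a W"
  have C_sub: "?C w \<subseteq> W" if "w \<in> W" for w using that by (rule color_component_subset)
  obtain x0 where x0: "x0 \<in> W" "?C x0 \<noteq> W" using not by (auto simp: color_connected_def)
  have C_ne: "?C w \<noteq> W" if "w \<in> W" for w
    using color_component_eq[of c x0 a W w, OF sym] x0 by metis
  \<comment> \<open>Some \<open>a\<close>-edge leaves the component in the larger graph, and it can
    only end in \<open>v\<close>.\<close>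
  have v_edge: "\<exists>w'\<in>?C w. c v w' = a" if w: "w \<in> W" for w
  proof -
    have "?C w \<subseteq> insert v W" "?C w \<noteq> {}" "?C w \<noteq> insert v W"
      using C_sub[OF w] color_component_refl[of w c a W] v by auto
    with con(1) obtain y u where yu: "y \<in> ?C w" "u \<in> insert v W - ?C w" "c y u = a"
      by (rule color_connected_cut)
    have "u \<notin> W" using color_component_no_edge[OF gW w, of u a y] yu sym[of y u] by auto
    then have "u = v" using yu by blast
    then show ?thesis using yu sym[of y u] by auto
  qed
  have sing: "{v} \<subseteq> insert v W" "{v} \<noteq> {}" "{v} \<noteq> insert v W" using W v by auto
  obtain x where x: "x \<in> W" "c v x = b" using color_connected_cut[OF con(2) sing] by auto
  obtain y where y: "y \<in> W" "c v y = d" using color_connected_cut[OF con(3) sing] by auto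
  \<comment> \<open>Take \<open>w'\<close> with \<open>c v w' = a\<close>. The triangle on
    \<open>v\<close>, \<open>x\<close>, \<open>w'\<close> has colors \<open>e\<close>,
    \<open>a\<close> and one other than \<open>a\<close>, which must be \<open>e\<close>.\<close>
  have key: "\<exists>w'\<in>?C w. c w' x = e" if x: "x \<in> W" "c v x = e" "e \<noteq> a" "w \<in> W" "x \<notin> ?C w" for x e w
  proof -
    obtain w' where w': "w' \<in> ?C w" "c v w' = a" using v_edge[OF x(4)] by blast
    have w'W: "w' \<in> W" using w' C_sub[OF x(4)] by blast
    have "c x w' \<noteq> a" using color_component_no_edge[OF gW x(4) x(1) x(5) w'(1)] .
    moreover have ne: "v \<noteq> x" "x \<noteq> w'" "v \<noteq> w'" using x w' v w'W by auto
    have "c v x = c x w' \<or> c x w' = c v w' \<or> c v x = c v w'"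
      using g ne x(1) w'W unfolding gallai_coloring_def by blast
    ultimately have "c x w' = e" using x(2,3) w'(2) by auto
    then show ?thesis using w'(1) sym by metis
  qed
  show False
  proof (cases "y \<in> ?C x")
    case False
    then have x_y: "x \<notin> ?C y" using color_component_eq[of c x a W y, OF sym] color_component_refl[of y c a W]
        color_component_eq[of c y a W x, OF sym] by metis
    obtain y' where y': "y' \<in> ?C y" "c y' x = b" using key[OF x abd(1)[symmetric] y(1) x_y] by blast
    obtain x' where x': "x' \<in> ?C x" "c x' y = d" using key[OF y abd(2)[symmetric] x(1) False] by blast
    \<comment> \<open>By homogeneity from either side, the edge \<open>x y\<close> has both colors
      \<open>b\<close> and \<open>d\<close>.\<close>
    have "c x y' = c x y" using color_component_homogeneous[OF gW y(1) x(1) x_y y'(1)] .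
    moreover have "c y x' = c y x" using color_component_homogeneous[OF gW x(1) y(1) False x'(1)] .
    ultimately show False using y'(2) x'(2) sym abd(3) by metis
  next
    case True
    obtain z where z: "z \<in> W" "z \<notin> ?C x" using C_ne[OF x(1)] C_sub[OF x(1)] by blast
    have Czx: "?C z \<inter> ?C x = {}"
      using color_component_eq[of c _ a W z, OF sym] color_component_eq[of c _ a W x, OF sym] z(2)
        color_component_refl[of z c a W] by blast
    have xz: "x \<notin> ?C z" using Czx color_component_refl[of x c a W] by blast
    have yz: "y \<notin> ?C z" using Czx True by blast
    obtain w where w: "w \<in> ?C z" "c w x = b" using key[OF x abd(1)[symmetric] z(1) xz] by blast
    obtain w' where w': "w' \<in> ?C z" "c w' y = d" using key[OF y abd(2)[symmetric] z(1) yz] by blast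
    have wW: "w \<in> W" "w \<notin> ?C x" using w(1) C_sub[OF z(1)] Czx by auto
    \<comment> \<open>From \<open>w\<close>, the vertices \<open>x\<close> and \<open>y\<close> look
      alike; from \<open>y\<close>, the vertices \<open>w\<close> and \<open>w'\<close> do. So the
      edge \<open>w y\<close> has both colors.\<close>
    have "c w y = c w x" using color_component_homogeneous[OF gW x(1) wW True] .
    moreover have "c y w = c y w'"
      using color_component_homogeneous[OF gW z(1) y(1) yz w(1)]
        color_component_homogeneous[OF gW z(1) y(1) yz w'(1)] by simp
    ultimately show False using w(2) w'(2) sym abd(3) by metis
  qed
qed

text \<open>By induction, deleting a vertex disconnects one of the three colors, and the previous
  lemma applies to that color.\<close>

lemma gallai_not_three_connected:
  assumes "finite V" "card V \<ge> 2" "gallai_coloring c V"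
    and "\<And>x y. x \<in> V \<Longrightarrow> y \<in> V \<Longrightarrow> x \<noteq> y \<Longrightarrow> c x y \<in> {a, b, d}"
    and abd: "a \<noteq> b" "a \<noteq> d" "b \<noteq> d"
  shows "\<not> (color_connected c a V \<and> color_connected c b V \<and> color_connected c d V)"
  using assms(1-4)
proof (induction V rule: finite_induct)
  case (insert v W)
  show ?case
  proof
    assume con: "color_connected c a (insert v W) \<and> color_connected c b (insert v W)
      \<and> color_connected c d (insert v W)"
    have W: "W \<noteq> {}" using insert.prems(1) by auto
    have nc: "\<not> color_connected c a W \<or> \<not> color_connected c b W \<or> \<not> color_connected c d W"
    proof (cases "card W \<ge> 2")
      case True
      have "gallai_coloring c W" using insert.prems(2) by (rule gallai_coloring_subset) auto
      then show ?thesis using insert.IH[OF True] insert.prems(3) by blast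
    next
      case False
      \<comment> \<open>A single edge cannot connect its ends in two colors.\<close>
      then have "card W = 1" using W insert.hyps(1) by (metis One_nat_def Suc_1 card_0_eq less_2_cases not_le)
      then obtain w where w: "W = {w}" by (auto simp: card_1_singleton_iff)
      have sing: "{v} \<subseteq> insert v W" "{v} \<noteq> {}" "{v} \<noteq> insert v W" using W insert.hyps(2) by auto
      have "c v w = a" using color_connected_cut[OF conjunct1[OF con] sing] w by blast
      moreover have "c v w = b"
        using color_connected_cut[OF conjunct1[OF conjunct2[OF con]] sing] w by blast
      ultimately show ?thesis using abd by simp
    qed
    note step = gallai_three_connected_step[OF insert.prems(2) insert.hyps(2) W]
    from nc show False
    proof (elim disjE)
      assume "\<not> color_connected c a W"
      then show False using step[of a b d] insert.prems(3) abd con by blast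
    next
      assume "\<not> color_connected c b W"
      then show False using step[of b a d] insert.prems(3) abd con by blast
    next
      assume "\<not> color_connected c d W"
      then show False using step[of d a b] insert.prems(3) abd con by blast
    qed
  qed
qed simp

section \<open>Prime interval graphs\<close>

lemma chain_eq_if_card_eq:
  assumes fin: "finite V" and chain: "\<And>v w. Q v \<subseteq> Q w \<or> Q w \<subseteq> Q v" and sub: "\<And>v. Q v \<subseteq> V"
    and card: "card (Q v) = card (Q w)"
  shows "Q v = Q w"
  using chain[of v w] card_subset_eq[OF finite_subset[OF sub fin]] card by metis

text \<open>\<open>P u v\<close> abstracts that the interval of \<open>u\<close> lies entirely to
  the left of that of \<open>v\<close>. A strict order without two independent chains of length two
  is an interval order, and \<open>E\<close> is its incomparability graph on
  \<open>X\<close>.\<close>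

locale interval_order_graph = simple_graph_relation E for E :: "'a \<Rightarrow> 'a \<Rightarrow> bool" +
  fixes X :: "'a set" and P :: "'a \<Rightarrow> 'a \<Rightarrow> bool"
  assumes P_trans: "P u v \<Longrightarrow> P v w \<Longrightarrow> P u w"
    and P_irrefl: "\<not> P v v"
    and P_nonadjacent: "P u v \<Longrightarrow> \<not> E u v"
    and P_total: "u \<in> X \<Longrightarrow> v \<in> X \<Longrightarrow> u \<noteq> v \<Longrightarrow> \<not> E u v \<Longrightarrow> P u v \<or> P v u"
    and P_two_two_free: "P u v \<Longrightarrow> P u' v' \<Longrightarrow> P u v' \<or> P u' v"
begin

lemma P_asym: "P u v \<Longrightarrow> \<not> P v u"
  using P_trans P_irrefl by blast

lemma E_iff_P:
  assumes "u \<in> X" "v \<in> X" "u \<noteq> v"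
  shows "E u v \<longleftrightarrow> \<not> P u v \<and> \<not> P v u"
  using P_total[OF assms] P_nonadjacent[of u v] P_nonadjacent[of v u] E_commute[of u v] by blast

definition prime_graph :: "'a set \<Rightarrow> bool" where
  "prime_graph V \<longleftrightarrow> (\<forall>M. graph_module V M \<longrightarrow> card M \<le> 1 \<or> M = V)"

lemma no_pair_module:
  assumes "prime_graph V" "card V \<ge> 3" "u \<noteq> v" "u \<in> V" "v \<in> V"
    "\<And>w. w \<in> V \<Longrightarrow> w \<noteq> u \<Longrightarrow> w \<noteq> v \<Longrightarrow> E w u \<longleftrightarrow> E w v"
  shows False
proof -
  have "graph_module V {u, v}" using assms(4-6) by (auto simp: graph_module_def)
  then have "card {u, v} \<le> 1 \<or> {u, v} = V" using assms(1) unfolding prime_graph_def by blast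
  then show False using assms(2,3) by auto
qed

text \<open>Otherwise all three colors of pairs occur. In a prime graph every color that occurs is
  connected, which is impossible for three colors without rainbow triangles.\<close>

lemma prime_order_preserving_or_reversing:
  assumes VX: "V \<subseteq> X" and V: "finite V" "card V \<ge> 3" and prime: "prime_graph V"
    and s: "s \<in> auts V l"
  shows "(\<forall>u\<in>V. \<forall>v\<in>V. P (s u) (s v) \<longleftrightarrow> P u v) \<or> (\<forall>u\<in>V. \<forall>v\<in>V. P (s u) (s v) \<longleftrightarrow> P v u)"
proof (rule ccontr)
  assume contra: "\<not> ?thesis"
  define agree where "agree u v \<longleftrightarrow> (P (s u) (s v) \<longleftrightarrow> P u v) \<and> (P (s v) (s u) \<longleftrightarrow> P v u)" for u v
  \<comment> \<open>Color 0: adjacent; color 1: ordered as the images are; color 2: ordered the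
    opposite way.\<close>
  define c where "c u v = (if E u v then 0 else if agree u v then 1 else (2::nat))" for u v
  have csym: "c u v = c v u" for u v using E_commute[of u v] by (auto simp: c_def agree_def)
  have c_0: "c u v = 0 \<longleftrightarrow> E u v" for u v by (simp add: c_def)
  have EP: "E u v \<longleftrightarrow> \<not> P u v \<and> \<not> P v u" "E u v \<longleftrightarrow> \<not> P (s u) (s v) \<and> \<not> P (s v) (s u)"
    if "u \<in> V" "v \<in> V" "u \<noteq> v" for u v
  proof -
    show "E u v \<longleftrightarrow> \<not> P u v \<and> \<not> P v u" using E_iff_P that VX by blast
    have "E u v \<longleftrightarrow> E (s u) (s v)" using auts_E[OF s] that by blast
    also have "\<dots> \<longleftrightarrow> \<not> P (s u) (s v) \<and> \<not> P (s v) (s u)"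
      using E_iff_P[of "s u" "s v"] that VX auts_in[OF s] auts_inj[OF s] by blast
    finally show "E u v \<longleftrightarrow> \<not> P (s u) (s v) \<and> \<not> P (s v) (s u)" .
  qed
  \<comment> \<open>By transitivity \<open>y\<close> cannot lie between the adjacent vertices
    \<open>x\<close> and \<open>z\<close>, so it is on the same side of both. The same holds for the
    images.\<close>
  have force: "c x y = c y z" if xyz: "x \<in> V" "y \<in> V" "z \<in> V" "x \<noteq> y" "y \<noteq> z" "x \<noteq> z"
    and e: "E x z" "\<not> E x y" "\<not> E y z" for x y z
  proof -
    have "P x y \<longleftrightarrow> P z y" "P y x \<longleftrightarrow> P y z"
      using EP(1)[of x z] EP(1)[of x y] EP(1)[of y z] xyz e P_trans by blast+
    moreover have "P (s x) (s y) \<longleftrightarrow> P (s z) (s y)" "P (s y) (s x) \<longleftrightarrow> P (s y) (s z)"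
      using EP(2)[of x z] EP(2)[of x y] EP(2)[of y z] xyz e P_trans by blast+
    ultimately show ?thesis using e by (auto simp: c_def agree_def)
  qed
  have g: "gallai_coloring c V"
    unfolding gallai_coloring_def
  proof (intro conjI allI ballI impI)
    fix x y z assume xyz: "x \<in> V" "y \<in> V" "z \<in> V" "x \<noteq> y" "y \<noteq> z" "x \<noteq> z"
    \<comment> \<open>Two adjacent pairs share color 0, and three nonadjacent pairs use only two
      colors. With exactly one adjacent pair, \<open>force\<close> applies.\<close>
    consider "E x z" "\<not> E x y" "\<not> E y z" | "E x y" "\<not> E x z" "\<not> E y z" | "E y z" "\<not> E x y" "\<not> E x z"
      | "E x z" "E x y" | "E x z" "E y z" | "E x y" "E y z" | "\<not> E x z" "\<not> E x y" "\<not> E y z" by blast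
    then show "c x y = c y z \<or> c y z = c x z \<or> c x y = c x z"
    proof cases
      case 1 then show ?thesis using force xyz by blast
    next
      case 2
      then have "c x z = c z y" using force[of x z y] xyz E_commute by auto
      then show ?thesis using csym by metis
    next
      case 3
      then have "c y x = c x z" using force[of y x z] xyz E_commute by auto
      then show ?thesis using csym by metis
    qed (auto simp: c_def)
  qed (rule csym)
  \<comment> \<open>Components of one color are modules because equal colors mean equal adjacency.
    The one containing an edge of that color has two vertices, so by primality it is
    \<open>V\<close>.\<close>
  have conn: "color_connected c a V" if uv: "u \<in> V" "v \<in> V" "u \<noteq> v" "c u v = a" for a u v
  proof (rule ccontr)
    let ?M = "color_component c a V u"
    assume "\<not> color_connected c a V"
    then obtain x where x: "x \<in> V" "color_component c a V x \<noteq> V" by (auto simp: color_connected_def)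
    have M: "u \<in> ?M" "?M \<subseteq> V" using color_component_refl[of u c a V] color_component_subset[OF uv(1), of c a] by auto
    moreover have vM: "v \<in> ?M" using color_component_step[OF M(1) uv] .
    moreover have "?M \<noteq> V" using color_component_eq[of c x a V u, OF csym] x by metis
    moreover have "graph_module V ?M"
      unfolding graph_module_def
    proof (intro conjI ballI)
      fix w y z assume w: "w \<in> V - ?M" and yz: "y \<in> ?M" "z \<in> ?M"
      have "c w y = c w z"
        using color_component_homogeneous[OF g uv(1), of w a] w yz by force
      then show "E w y \<longleftrightarrow> E w z" using c_0 by metis
    qed (rule M(2))
    ultimately have "card ?M \<le> 1" using prime unfolding prime_graph_def by blast
    moreover have "card {u, v} \<le> card ?M" using M vM V(1) by (intro card_mono) (auto intro: finite_subset)
    ultimately show False using uv(3) by simp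
  qed
  have "\<exists>u\<in>V. \<exists>v\<in>V. u \<noteq> v \<and> c u v = 0"
  proof (rule ccontr)
    assume "\<not> (\<exists>u\<in>V. \<exists>v\<in>V. u \<noteq> v \<and> c u v = 0)"
    then have noE: "\<not> E u v" if "u \<in> V" "v \<in> V" "u \<noteq> v" for u v using that c_0 by blast
    obtain u v where "u \<in> V" "v \<in> V" "u \<noteq> v"
      using V by (metis One_nat_def card_le_Suc0_iff_eq le_trans not_less_eq_eq numeral_3_eq_3 le_SucI)
    then show False using no_pair_module[OF prime V(2), of u v] noE by blast
  qed
  then have "color_connected c 0 V" using conn by blast
  moreover have "\<exists>u\<in>V. \<exists>v\<in>V. u \<noteq> v \<and> c u v = 1"
  proof -
    \<comment> \<open>A pair where \<open>s\<close> fails to reverse the order has color 1; one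
      where it fails to preserve the order has color 2.\<close>
    from contra obtain u v where uv: "u \<in> V" "v \<in> V" "P (s u) (s v) \<noteq> P v u" by blast
    then have ne: "u \<noteq> v" using P_irrefl by auto
    then have "c u v = 1" using uv EP[of u v] P_asym[of u v] P_asym[of "s u" "s v"] by (auto simp: c_def agree_def)
    with uv ne show ?thesis by blast
  qed
  then have "color_connected c 1 V" using conn by blast
  moreover have "\<exists>u\<in>V. \<exists>v\<in>V. u \<noteq> v \<and> c u v = 2"
  proof -
    from contra obtain u v where uv: "u \<in> V" "v \<in> V" "P (s u) (s v) \<noteq> P u v" by blast
    then have ne: "u \<noteq> v" using P_irrefl by auto
    then have "c u v = 2" using uv EP[of u v] by (auto simp: c_def agree_def)
    with uv ne show ?thesis by blast
  qed
  then have "color_connected c 2 V" using conn by blast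
  moreover have "c x y \<in> {0, 1, 2}" for x y by (simp add: c_def)
  ultimately show False using gallai_not_three_connected[OF V(1) _ g, of 0 1 2] V(2) by auto
qed

text \<open>Predecessor sets in an interval order form a chain, and so do successor sets. Those of
  \<open>v\<close> and \<open>s v\<close> have equal sizes, hence coincide, so distinct
  \<open>v\<close> and \<open>s v\<close> would be twins and form a module.\<close>

lemma prime_order_preserving_id:
  assumes VX: "V \<subseteq> X" and V: "finite V" "card V \<ge> 3" and prime: "prime_graph V"
    and s: "s \<in> auts V l" and mono: "\<And>u v. u \<in> V \<Longrightarrow> v \<in> V \<Longrightarrow> P (s u) (s v) \<longleftrightarrow> P u v"
  shows "s = id"
proof (rule auts_eq_idI[OF s], rule ccontr)
  fix v assume v: "v \<in> V" and ne: "s v \<noteq> v"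
  have sv: "s v \<in> V" using v auts_in[OF s] by simp
  have sV: "s ` V = V" using permutes_image[OF auts_permutes[OF s]] .
  have inj: "inj_on s A" for A using auts_inj[OF s] by (auto simp: inj_on_def)
  have card: "card {u \<in> V. Q u} = card {u \<in> V. Q (s u)}" for Q
  proof -
    have "{u \<in> s ` V. Q u} = s ` {u \<in> V. Q (s u)}" by blast
    then show ?thesis using card_image[OF inj] unfolding sV by simp
  qed
  have "{u \<in> V. P (s u) (s v)} = {u \<in> V. P u v}" using mono v by blast
  then have "card {u \<in> V. P u (s v)} = card {u \<in> V. P u v}" using card[of "\<lambda>u. P u (s v)"] by simp
  then have pred: "{u \<in> V. P u (s v)} = {u \<in> V. P u v}"
    by (intro chain_eq_if_card_eq[OF V(1), of "\<lambda>v. {u \<in> V. P u v}"]) (use P_two_two_free in blast)+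
  have "{u \<in> V. P (s v) (s u)} = {u \<in> V. P v u}" using mono v by blast
  then have "card {u \<in> V. P (s v) u} = card {u \<in> V. P v u}" using card[of "P (s v)"] by simp
  then have succ: "{u \<in> V. P (s v) u} = {u \<in> V. P v u}"
    by (intro chain_eq_if_card_eq[OF V(1), of "\<lambda>v. {u \<in> V. P v u}"]) (use P_two_two_free in blast)+
  show False
  proof (rule no_pair_module[OF prime V(2) ne sv v])
    fix w assume w: "w \<in> V" "w \<noteq> s v" "w \<noteq> v"
    have "P w (s v) \<longleftrightarrow> P w v" "P (s v) w \<longleftrightarrow> P v w" using pred succ w(1) by blast+
    then show "E w (s v) \<longleftrightarrow> E w v" using E_iff_P[of w v] E_iff_P[of w "s v"] w v sv VX by blast
  qed
qed

text \<open>Every nontrivial automorphism reverses the order. Two of them differ by an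
  order-preserving one, that is, by the identity.\<close>

lemma prime_auts:
  assumes VX: "V \<subseteq> X" and V: "finite V" "card V \<ge> 3" and prime: "prime_graph V"
  shows "\<exists>t. auts V l = {id, t}"
proof (cases "auts V l = {id}")
  case False
  then obtain t where t: "t \<in> auts V l" "t \<noteq> id" using id_in_auts by blast
  note pid = prime_order_preserving_id[OF VX V prime]
  note por = prime_order_preserving_or_reversing[OF VX V prime]
  have rev: "P (r u) (r v) \<longleftrightarrow> P v u" if "r \<in> auts V l" "r \<noteq> id" "u \<in> V" "v \<in> V" for r u v
    using por[OF that(1)] pid[OF that(1)] that by blast
  have "s = t" if s: "s \<in> auts V l" "s \<noteq> id" for s
  proof -
    have it: "inv t \<in> auts V l" using inv_in_auts[OF t(1)] .
    have a: "inv t \<circ> s \<in> auts V l" using comp_in_auts[OF it s(1)] .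
    have "inv t \<circ> s = id"
    proof (rule pid[OF a])
      fix u v assume uv: "u \<in> V" "v \<in> V"
      have "(inv t \<circ> s) u \<in> V" "(inv t \<circ> s) v \<in> V" using auts_in[OF a] uv by auto
      then have "P ((inv t \<circ> s) u) ((inv t \<circ> s) v) \<longleftrightarrow> P (t ((inv t \<circ> s) v)) (t ((inv t \<circ> s) u))"
        using rev[OF t] by blast
      also have "\<dots> \<longleftrightarrow> P (s v) (s u)" using auts_inv_right[OF t(1)] by simp
      also have "\<dots> \<longleftrightarrow> P u v" using rev[OF s] uv by blast
      finally show "P ((inv t \<circ> s) u) ((inv t \<circ> s) v) \<longleftrightarrow> P u v" .
    qed
    then show "s = t" using auts_inv_right[OF t(1)] by (metis comp_apply eq_id_iff ext)
  qed
  then have "auts V l = {id, t}" using t(1) id_in_auts by blast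
  then show ?thesis by (rule exI[of _ t])
qed auto

end

section \<open>Existence of block modules\<close>

context simple_graph_relation
begin

text \<open>Blocks in the sense of permutation group theory.\<close>

definition block :: "'a set \<Rightarrow> ('a \<Rightarrow> nat) \<Rightarrow> 'a set \<Rightarrow> bool" where
  "block V l M \<longleftrightarrow> (\<forall>s\<in>auts V l. s ` M \<inter> M \<noteq> {} \<longrightarrow> s ` M = M)"

lemma block_images:
  assumes "block V l M" "s \<in> auts V l" "t \<in> auts V l" "s ` M \<inter> t ` M \<noteq> {}"
  shows "s ` M = t ` M"
proof -
  have r: "inv t \<circ> s \<in> auts V l" using assms comp_in_auts inv_in_auts by blast
  obtain x y where xy: "x \<in> M" "y \<in> M" "s x = t y" using assms(4) by blast
  then have "(inv t \<circ> s) x = y" using auts_inv_left[OF assms(3)] by simp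
  then have "y \<in> (inv t \<circ> s) ` M \<inter> M" using xy by blast
  then have "(inv t \<circ> s) ` M = M" using assms(1) r unfolding block_def by blast
  then have "t ` M = t ` (inv t \<circ> s) ` M" by simp
  also have "\<dots> = s ` M" using auts_inv_right[OF assms(3)] by (simp add: image_comp comp_def)
  finally show ?thesis by simp
qed

text \<open>The module and the contracted graph are both smaller, so contraction applies to the
  orbit of \<open>M\<close>.\<close>

lemma list_good_if_block_module:
  assumes V: "finite V" and M: "graph_module V M" "card M \<ge> 2" "M \<noteq> V" and b: "block V l M"
    and IH: "\<And>W l'. W \<subseteq> V \<Longrightarrow> card W < card V \<Longrightarrow> list_good W l'"
  shows "list_good V l"
proof -
  obtain m where m: "m \<in> M" using M(2) by fastforce
  \<comment> \<open>\<open>B\<close> is the orbit of \<open>M\<close>, \<open>g\<close> chooses an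
    automorphism for each image, \<open>J\<close> collects the images of the base point
    \<open>m\<close>, and \<open>blk\<close> recovers the image from its point.\<close>
  define B where "B = (\<lambda>s. s ` M) ` auts V l"
  define g where "g X = (SOME s. s \<in> auts V l \<and> s ` M = X)" for X
  have g: "g X \<in> auts V l" "g X ` M = X" if "X \<in> B" for X
    using someI_ex[of "\<lambda>s. s \<in> auts V l \<and> s ` M = X"] that unfolding g_def B_def by auto
  have disj: "X = Y" if "X \<in> B" "Y \<in> B" "X \<inter> Y \<noteq> {}" for X Y
    using block_images[OF b g(1)[OF that(1)] g(1)[OF that(2)]] g(2) that by simp
  define J where "J = (\<lambda>X. g X m) ` B"
  define blk where "blk j = (SOME X. X \<in> B \<and> g X m = j)" for j
  have blk: "blk j \<in> B" "g (blk j) m = j" if "j \<in> J" for j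
    using someI_ex[of "\<lambda>X. X \<in> B \<and> g X m = j"] that unfolding blk_def J_def by auto
  \<comment> \<open>A label above all labels in use is fresh.\<close>
  define z where "z = Suc (Max (l ` V))"
  interpret bc: block_contraction E V M J "\<Union>j\<in>J. g (blk j) ` M"
    "(V - (\<Union>j\<in>J. g (blk j) ` M)) \<union> J" l "\<lambda>v. if v \<in> J then z else l v" m "\<lambda>j. g (blk j)" z
    "\<lambda>v. if v \<in> (\<Union>j\<in>J. g (blk j) ` M) then (THE j. j \<in> J \<and> v \<in> g (blk j) ` M) else v"
  proof (unfold_locales)
    show "finite V" "graph_module V M" "m \<in> M" by fact+
    show "g (blk j) \<in> auts V l" "g (blk j) m = j" if "j \<in> J" for j using g blk that by auto
    show "g (blk j) ` M \<inter> g (blk k) ` M = {}" if "j \<in> J" "k \<in> J" "j \<noteq> k" for j k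
      using disj[of "blk j" "blk k"] g(2) blk that by metis
    show "\<exists>j\<in>J. s ` M = g (blk j) ` M" if s: "s \<in> auts V l" for s
    proof -
      have X: "s ` M \<in> B" using s by (simp add: B_def)
      define j where "j = g (s ` M) m"
      have j: "j \<in> J" using X by (simp add: J_def j_def)
      have "j \<in> s ` M" using g(2)[OF X] m unfolding j_def by blast
      moreover have "j \<in> blk j" using imageI[OF m, of "g (blk j)"] g(2)[OF blk(1)[OF j]] blk(2)[OF j] by simp
      ultimately have "s ` M = blk j" using disj[OF X blk(1)[OF j]] by blast
      then have "s ` M = g (blk j) ` M" using g(2)[OF blk(1)[OF j]] by simp
      with j show ?thesis by (rule bexI[rotated])
    qed
    show "l v \<noteq> z" if "v \<in> V" for v
      using Max_ge[of "l ` V" "l v"] V that unfolding z_def by (metis Suc_n_not_le_n finite_imageI imageI)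
  qed auto
  have "card M < card V" using M V by (metis graph_module_def psubset_card_mono psubsetI)
  then have "list_good M l" using IH bc.M_sub by blast
  then show ?thesis
    by (rule bc.list_good_of_quot) (rule IH[OF bc.V'_sub bc.card_V'_less[OF M(2)]])
qed

section \<open>Modules under automorphisms, unions and components\<close>

lemma image_graph_module:
  assumes M: "graph_module V M" and s: "s \<in> auts V l"
  shows "graph_module V (s ` M)"
  unfolding graph_module_def
proof (intro conjI ballI)
  show "s ` M \<subseteq> V" using M auts_in[OF s] by (auto simp: graph_module_def)
  fix v x y assume v: "v \<in> V - s ` M" and xy: "x \<in> s ` M" "y \<in> s ` M"
  obtain x' y' where xy': "x' \<in> M" "y' \<in> M" "x = s x'" "y = s y'" using xy by blast
  define w where "w = inv s v"
  have sw: "s w = v" using auts_inv_right[OF s] by (simp add: w_def)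
  then have w: "w \<in> V" "w \<notin> M" using v auts_in[OF s, of w] by auto
  have "E w x' \<longleftrightarrow> E w y'" using M w xy' unfolding graph_module_def by blast
  moreover have "x' \<in> V" "y' \<in> V" using M xy' unfolding graph_module_def by auto
  ultimately show "E v x \<longleftrightarrow> E v y" using auts_E[OF s] w(1) sw xy'(3,4) by metis
qed

lemma union_graph_module:
  assumes "graph_module V M" "graph_module V N" "M \<inter> N \<noteq> {}"
  shows "graph_module V (M \<union> N)"
proof -
  obtain w where w: "w \<in> M" "w \<in> N" using assms(3) by blast
  have *: "E v x \<longleftrightarrow> E v w" if "v \<in> V - (M \<union> N)" "x \<in> M \<union> N" for v x
    using assms(1,2) that w unfolding graph_module_def by blast
  show ?thesis unfolding graph_module_def
  proof (intro conjI ballI)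
    show "M \<union> N \<subseteq> V" using assms(1,2) unfolding graph_module_def by blast
    fix v x y assume "v \<in> V - (M \<union> N)" "x \<in> M \<union> N" "y \<in> M \<union> N"
    then show "E v x \<longleftrightarrow> E v y" using * by metis
  qed
qed

text \<open>Adjacency as a coloring by \<open>True\<close> and \<open>False\<close> has only two
  colors. The results on Gallai colorings thereby treat components and co-components
  uniformly.\<close>

lemma E_gallai_coloring: "gallai_coloring E V"
  unfolding gallai_coloring_def using E_commute by auto

text \<open>Components are modules by homogeneity. They are blocks because automorphisms map
  monochromatic paths to such paths, so components go to components.\<close>

lemma color_component_block_module:
  assumes u: "u \<in> V"
  shows "graph_module V (color_component E a V u)" "block V l (color_component E a V u)"
proof -
  let ?C = "color_component E a V"
  show "graph_module V (?C u)"
    unfolding graph_module_def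
  proof (intro conjI ballI)
    show "?C u \<subseteq> V" using color_component_subset[OF u] .
    fix v x y assume "v \<in> V - ?C u" "x \<in> ?C u" "y \<in> ?C u"
    then show "E v x \<longleftrightarrow> E v y"
      using color_component_homogeneous[OF E_gallai_coloring u, of v a] by auto
  qed
  have eq: "?C y = ?C x" if "y \<in> ?C x" for x y
    by (rule color_component_eq[OF _ that]) (rule E_commute)
  have img: "s y \<in> ?C (s x)" if s: "s \<in> auts V l" and y: "y \<in> ?C x" for s x y
  proof -
    have "(x, y) \<in> (color_rel E a V)\<^sup>*" using y by (simp add: color_component_def)
    then show ?thesis
    proof (induction rule: rtrancl_induct)
      case base show ?case by (rule color_component_refl)
    next
      case (step y z)
      have yz: "y \<in> V" "z \<in> V" "y \<noteq> z" "E y z = a" using step.hyps(2) by (auto simp: color_rel_def)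
      show ?case
        by (rule color_component_step[OF step.IH])
          (use yz auts_in[OF s] auts_inj[OF s] auts_E[OF s] in auto)
    qed
  qed
  show "block V l (?C u)"
    unfolding block_def
  proof (intro ballI impI)
    fix s assume s: "s \<in> auts V l" and "s ` ?C u \<inter> ?C u \<noteq> {}"
    then obtain y where y: "y \<in> ?C u" "s y \<in> ?C u" by blast
    have "?C (s u) = ?C u" using eq[OF img[OF s y(1)]] eq[OF y(2)] by simp
    then have sub: "s ` ?C u \<subseteq> ?C u" using img[OF s] by blast
    moreover have "?C u \<subseteq> s ` ?C u"
    proof
      fix w assume w: "w \<in> ?C u"
      have "inv s w \<in> ?C (inv s (s u))"
        using img[OF inv_in_auts[OF s], of w "s u"] w \<open>?C (s u) = ?C u\<close> by simp
      then have "inv s w \<in> ?C u" using auts_inv_left[OF s] by simp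
      then show "w \<in> s ` ?C u" using auts_inv_right[OF s, of w] by (metis imageI)
    qed
    ultimately show "s ` ?C u = ?C u" by blast
  qed
qed

text \<open>Take a largest proper module \<open>M\<close>. If it properly overlapped an image
  \<open>N\<close>, the union would be a larger module, hence \<open>V\<close>; then
  \<open>A = M - N\<close> would be joined completely or not at all to \<open>N\<close>, against
  connectedness of the graph and its complement.\<close>

lemma block_module_if_connected:
  assumes V: "finite V" and con: "color_connected E True V" "color_connected E False V"
    and M0: "graph_module V M0" "card M0 \<ge> 2" "M0 \<noteq> V"
  shows "\<exists>M. graph_module V M \<and> card M \<ge> 2 \<and> M \<noteq> V \<and> block V l M"
proof -
  let ?Q = "\<lambda>M. graph_module V M \<and> card M \<ge> 2 \<and> M \<noteq> V"
  have "\<forall>M. ?Q M \<longrightarrow> card M < Suc (card V)"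
    using V by (auto simp: graph_module_def less_Suc_eq_le intro: card_mono)
  then obtain M where M: "?Q M" and max: "\<And>N. ?Q N \<Longrightarrow> card N \<le> card M"
    using ex_has_greatest_nat[of ?Q M0 card "Suc (card V)"] M0 by blast
  have "block V l M"
    unfolding block_def
  proof (intro ballI impI, rule ccontr)
    fix s assume s: "s \<in> auts V l" and int: "s ` M \<inter> M \<noteq> {}" and ne: "s ` M \<noteq> M"
    let ?N = "s ` M"
    have MV: "M \<subseteq> V" and finM: "finite M" using M V finite_subset by (auto simp: graph_module_def)
    have N: "graph_module V ?N" using image_graph_module M s by blast
    have cN: "card ?N = card M" using auts_inj[OF s] by (intro card_image) (auto simp: inj_on_def)
    have nsub: "\<not> ?N \<subseteq> M" "\<not> M \<subseteq> ?N"
      using card_subset_eq[of M ?N] card_subset_eq[of ?N M] finM cN ne by auto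
    have mod: "graph_module V (M \<union> ?N)" using union_graph_module[of V M ?N] M N int by blast
    have "card M < card (M \<union> ?N)" using nsub finM by (intro psubset_card_mono) auto
    then have un: "M \<union> ?N = V" using max[of "M \<union> ?N"] mod M by fastforce
    obtain c where c: "c \<in> ?N" "c \<notin> M" using nsub by blast
    define A where "A = M - ?N"
    have VA: "V - A = ?N" using un by (auto simp: A_def)
    have A: "A \<subseteq> V" "A \<noteq> {}" "A \<noteq> V" using nsub MV c un unfolding A_def by blast+
    \<comment> \<open>A vertex of \<open>A\<close> sees all of the image alike, and
      \<open>c\<close>, being outside \<open>M\<close>, sees all of \<open>A\<close> alike.\<close>
    have AN: "E x y \<longleftrightarrow> E x c" if "x \<in> A" "y \<in> ?N" for x y
      using N that c A(1) unfolding graph_module_def A_def by blast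
    have Ac: "E x c \<longleftrightarrow> E x' c" if "x \<in> A" "x' \<in> A" for x x'
    proof -
      have "c \<in> V" using c(1) un by blast
      then have "E c x \<longleftrightarrow> E c x'" using M that c(2) unfolding graph_module_def A_def by blast
      then show ?thesis using E_commute by blast
    qed
    obtain x y where xy: "x \<in> A" "y \<in> ?N" "E x y = True"
      using color_connected_cut[OF con(1) A] VA by metis
    obtain x' y' where xy': "x' \<in> A" "y' \<in> ?N" "E x' y' = False"
      using color_connected_cut[OF con(2) A] VA by metis
    show False using AN[OF xy(1,2)] AN[OF xy'(1,2)] Ac[OF xy(1) xy'(1)] xy(3) xy'(3) by blast
  qed
  with M show ?thesis by blast
qed

text \<open>A disconnected color that occurs has a component with at least two vertices, which is a
  proper block module. If it does not occur, the graph is complete or empty, and only the labels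
  restrict automorphisms.\<close>

lemma block_module_or_list_good:
  assumes V: "finite V" and M0: "graph_module V M0" "card M0 \<ge> 2" "M0 \<noteq> V"
  shows "(\<exists>M. graph_module V M \<and> card M \<ge> 2 \<and> M \<noteq> V \<and> block V l M) \<or> list_good V l"
proof (cases "color_connected E True V \<and> color_connected E False V")
  case True
  then show ?thesis using block_module_if_connected[OF V _ _ M0] by blast
next
  case False
  then obtain a where a: "\<not> color_connected E a V" by blast
  then obtain x where x: "x \<in> V" "color_component E a V x \<noteq> V" by (auto simp: color_connected_def)
  have two: "card X \<ge> 2" if "u \<in> X" "v \<in> X" "u \<noteq> v" "X \<subseteq> V" for X u v
    using card_mono[of X "{u, v}"] that V finite_subset by fastforce
  show ?thesis
  proof (cases "\<exists>u\<in>V. \<exists>v\<in>V. u \<noteq> v \<and> E u v = a")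
    case True
    then obtain u v where uv: "u \<in> V" "v \<in> V" "u \<noteq> v" "E u v = a" by blast
    let ?M = "color_component E a V u"
    have "?M \<noteq> V" using color_component_eq[of E x a V u, OF E_commute] x by metis
    moreover have "u \<in> ?M" by (rule color_component_refl)
    moreover have "v \<in> ?M" using color_component_step[of u E a V u v] uv color_component_refl[of u E a V] by blast
    moreover have "?M \<subseteq> V" using color_component_subset[OF uv(1)] .
    ultimately show ?thesis using color_component_block_module[OF uv(1)] two[of u ?M v] uv(3) by blast
  next
    case False
    then have const: "E u v \<longleftrightarrow> \<not> a" if "u \<in> V" "v \<in> V" "u \<noteq> v" for u v using that by blast
    show ?thesis
    \<comment> \<open>A repeated label gives a label class as block module, or the full symmetric
      group if it is all of \<open>V\<close>; distinct labels leave only the identity.\<close>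
    proof (cases "\<exists>u\<in>V. \<exists>v\<in>V. u \<noteq> v \<and> l u = l v")
      case True
      then obtain u v where uv: "u \<in> V" "v \<in> V" "u \<noteq> v" "l u = l v" by blast
      define M where "M = {w \<in> V. l w = l u}"
      have c: "card M \<ge> 2" using two[of u M v] uv by (auto simp: M_def)
      have mod: "graph_module V M" using const unfolding graph_module_def M_def by auto
      have "s ` M \<subseteq> M" if "s \<in> auts V l" for s
        using auts_in[OF that] auts_label[OF that] by (auto simp: M_def)
      moreover have "inj_on s M" if "s \<in> auts V l" for s
        using auts_inj[OF that] by (auto simp: inj_on_def)
      ultimately have blk: "block V l M" unfolding block_def
        using endo_inj_surj[of M] V by (simp add: M_def)
      show ?thesis
      proof (cases "M = V")
        case False then show ?thesis using c mod blk by blast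
      next
        case True
        have "list_good V l"
        proof (rule list_good_full_symmetric[OF V])
          fix s assume s: "s permutes V"
          show "s \<in> auts V l"
          proof (rule autsI[OF s])
            fix p q assume pq: "p \<in> V" "q \<in> V"
            show "E (s p) (s q) \<longleftrightarrow> E p q"
            proof (cases "p = q")
              case True then show ?thesis using E_irrefl by simp
            next
              case False
              then have "s p \<noteq> s q" using permutes_inj[OF s] by (auto simp: inj_def)
              then show ?thesis using const False pq permutes_in_image[OF s] by blast
            qed
          next
            fix p assume p: "p \<in> V"
            have "l q = l u" if "q \<in> V" for q
            proof -
              have "q \<in> M" using that True by simp
              then show ?thesis by (simp add: M_def)
            qed
            then show "l (s p) = l p" using p permutes_in_image[OF s, of p] by simp
          qed
        qed
        then show ?thesis ..
      qed
    next
      case False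
      have "s = id" if s: "s \<in> auts V l" for s
        using False auts_eq_idI[OF s] auts_label[OF s] auts_in[OF s] by blast
      then have "auts V l = {id}" using id_in_auts by blast
      then show ?thesis using list_good_trivial_auts[OF V] by blast
    qed
  qed
qed

end

section \<open>Induction on the number of vertices\<close>

context interval_order_graph
begin

text \<open>Modules and contractions live on subsets of \<open>X\<close>, so the same order
  \<open>P\<close> serves throughout the induction.\<close>

theorem list_good_interval:
  assumes "finite V" "V \<subseteq> X"
  shows "list_good V l"
  using assms
proof (induction "card V" arbitrary: V l rule: less_induct)
  case (less V l)
  show ?case
  proof (cases "card V \<ge> 3")
    case False
    \<comment> \<open>With fewer than three vertices there are at most two permutations at
      all.\<close>
    then have "card V = 0 \<or> card V = 1 \<or> card V = 2" by linarith
    then have "card {s. s permutes V} \<le> 2" using card_permutations[OF refl less.prems(1)] by auto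
    moreover have "card (auts V l) \<le> card {s. s permutes V}"
      by (rule card_mono[OF finite_permutations[OF less.prems(1)]]) (auto simp: auts_def)
    ultimately have "card (auts V l) \<le> 2" by linarith
    then have "card (auts V l - {id}) \<le> Suc 0"
      using id_in_auts finite_auts[OF less.prems(1)] by (simp add: card_Diff_singleton)
    then have unique: "s = t" if "s \<in> auts V l - {id}" "t \<in> auts V l - {id}" for s t
      using card_le_Suc0_iff_eq[of "auts V l - {id}"] finite_auts[OF less.prems(1)] that by blast
    have "\<exists>t. auts V l = {id, t}"
    proof (cases "auts V l = {id}")
      case False
      then obtain t where "t \<in> auts V l - {id}" using id_in_auts by blast
      then have "auts V l = {id, t}" using unique id_in_auts by blast
      then show ?thesis by (rule exI[of _ t])
    qed auto
    then show ?thesis using list_good_card_auts_2[OF less.prems(1)] by (elim exE)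
  next
    case card: True
    show ?thesis
    proof (cases "prime_graph V")
      case True
      then obtain t where "auts V l = {id, t}" using prime_auts[OF less.prems(2,1) card] by blast
      then show ?thesis by (rule list_good_card_auts_2[OF less.prems(1)])
    next
      case False
      then obtain M0 where M0: "graph_module V M0" "card M0 \<ge> 2" "M0 \<noteq> V"
        unfolding prime_graph_def by force
      have IH: "list_good W l'" if "W \<subseteq> V" "card W < card V" for W l'
        using less.hyps[OF that(2)] that(1) less.prems finite_subset by blast
      from block_module_or_list_good[OF less.prems(1) M0, of l] show ?thesis
        using list_good_if_block_module[OF less.prems(1) _ _ _ _ IH] by blast
    qed
  qed
qed

end

section \<open>Interval graphs\<close>

text \<open>Otherwise \<open>y \<le> x\<close>. If \<open>x \<le> b\<close>, then \<open>x\<close>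
  lies between two points of \<open>B\<close>; if \<open>b < x\<close>, then \<open>b\<close> lies
  between two points of \<open>A\<close>.\<close>

lemma disjoint_intervals_less:
  fixes A B :: "real set"
  assumes "is_interval A" "is_interval B" "A \<inter> B = {}" "a \<in> A" "b \<in> B" "a < b" "x \<in> A" "y \<in> B"
  shows "x < y"
proof (rule ccontr)
  assume "\<not> x < y"
  then have "x \<in> B \<or> b \<in> A"
    using assms unfolding is_interval_1 by (metis less_imp_le linorder_le_cases not_le)
  with assms show False by blast
qed

context simple_graph_relation
begin

lemma distinguishing_iff_dist_coloring:
  assumes E: "\<And>u v. (u, v) \<in> parcs G \<longleftrightarrow> E u v"
  shows "distinguishing G p \<longleftrightarrow> dist_coloring (pverts G) (\<lambda>_. 0) p"
proof
  assume d: "distinguishing G p"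
  show "dist_coloring (pverts G) (\<lambda>_. 0) p"
    unfolding dist_coloring_def
  proof (intro ballI impI, rule ccontr)
    fix s v assume s: "s \<in> auts (pverts G) (\<lambda>_. 0)" "\<forall>v\<in>pverts G. p (s v) = p v"
      and v: "v \<in> pverts G" "s v \<noteq> v"
    have "graph_automorphism G s"
      using permutes_imp_bij[OF auts_permutes[OF s(1)]] auts_E[OF s(1)]
      by (simp add: graph_automorphism_def E)
    with d v s(2) show False unfolding distinguishing_def by blast
  qed
next
  assume d: "dist_coloring (pverts G) (\<lambda>_. 0) p"
  show "distinguishing G p"
    unfolding distinguishing_def
  proof (intro allI impI, rule ccontr)
    fix s assume s: "graph_automorphism G s \<and> (\<exists>v\<in>pverts G. s v \<noteq> v)"
      and "\<not> (\<exists>v\<in>pverts G. p (s v) \<noteq> p v)"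
    then have p: "p (s v) = p v" if "v \<in> pverts G" for v using that by blast
    \<comment> \<open>Graph automorphisms are unconstrained outside the vertex set; \<open>t\<close>
      normalizes \<open>s\<close> to a member of \<open>auts\<close>.\<close>
    define t where "t v = (if v \<in> pverts G then s v else v)" for v
    have t: "t v = s v" if "v \<in> pverts G" for v using that by (simp add: t_def)
    have "bij_betw t (pverts G) (pverts G)"
      using s bij_betw_cong[of "pverts G" t s "pverts G"] t unfolding graph_automorphism_def by blast
    then have "t permutes pverts G" by (rule bij_imp_permutes) (simp add: t_def)
    then have "t \<in> auts (pverts G) (\<lambda>_. 0)"
      using s by (intro autsI) (simp_all add: t graph_automorphism_def E)
    moreover have "\<forall>v\<in>pverts G. p (t v) = p v" using p t by simp
    ultimately have "\<forall>v\<in>pverts G. t v = v" using d unfolding dist_coloring_def by blast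
    with s t show False by auto
  qed
qed

end

lemma interval_order_graph_of_interval_graph:
  assumes "pair_graph G" "interval_graph G"
  obtains P where "interval_order_graph (\<lambda>u v. (u, v) \<in> parcs G) (pverts G) P"
proof -
  interpret pair_graph G by fact
  obtain I :: "'a \<Rightarrow> real set" where
    I: "\<And>v. v \<in> pverts G \<Longrightarrow> is_interval (I v)" "\<And>v. v \<in> pverts G \<Longrightarrow> I v \<noteq> {}"
    and adj: "\<And>u v. u \<in> pverts G \<Longrightarrow> v \<in> pverts G \<Longrightarrow> u \<noteq> v \<Longrightarrow> (u, v) \<in> parcs G \<longleftrightarrow> I u \<inter> I v \<noteq> {}"
    using assms(2) unfolding interval_graph_def by metis
  \<comment> \<open>Membership in \<open>pverts G\<close> guarantees nonempty intervals; an empty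
    one would break transitivity and irreflexivity.\<close>
  define P where "P u v \<longleftrightarrow> u \<in> pverts G \<and> v \<in> pverts G \<and> (\<forall>x\<in>I u. \<forall>y\<in>I v. x < y)" for u v
  have loop: "(v, v) \<notin> parcs G" for v using pair_no_loops[of "(v, v)"] by auto
  have "interval_order_graph (\<lambda>u v. (u, v) \<in> parcs G) (pverts G) P"
  proof unfold_locales
    show "(v, u) \<in> parcs G" if "(u, v) \<in> parcs G" for u v
      using pair_sym_arcs that by (auto simp: symmetric_def sym_def)
    show "(v, v) \<notin> parcs G" for v by (rule loop)
    show "P u w" if "P u v" "P v w" for u v w
    proof -
      obtain y where "y \<in> I v" using I(2) \<open>P u v\<close> unfolding P_def by blast
      then show ?thesis using that unfolding P_def by (meson less_trans)
    qed
    show "\<not> P v v" for v using I(2)[of v] unfolding P_def by (metis all_not_in_conv less_irrefl)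
    show "(u, v) \<notin> parcs G" if "P u v" for u v
      using that adj[of u v] loop[of u] unfolding P_def by (metis disjoint_iff less_irrefl)
    show "P u v \<or> P v u" if uv: "u \<in> pverts G" "v \<in> pverts G" "u \<noteq> v" "(u, v) \<notin> parcs G" for u v
    proof -
      have dis: "I u \<inter> I v = {}" using adj uv by blast
      obtain x y where xy: "x \<in> I u" "y \<in> I v" using I(2) uv by blast
      then have "x \<noteq> y" using dis by blast
      then consider "x < y" | "y < x" by linarith
      then show ?thesis
      proof cases
        case 1
        then have "P u v"
          unfolding P_def using disjoint_intervals_less[OF I(1) I(1) dis xy] uv by blast
        then show ?thesis ..
      next
        case 2
        have "I v \<inter> I u = {}" using dis by blast
        then have "P v u"
          unfolding P_def using disjoint_intervals_less[OF I(1) I(1) _ xy(2,1) 2] uv by blast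
        then show ?thesis ..
      qed
    qed
    show "P u v' \<or> P u' v" if P: "P u v" "P u' v'" for u v u' v'
    proof (rule ccontr)
      assume "\<not> (P u v' \<or> P u' v)"
      \<comment> \<open>Two failures would give the cycle
        \<open>x < y \<le> x' < y' \<le> x\<close>.\<close>
      then obtain x y' x' y where "x \<in> I u" "y' \<in> I v'" "\<not> x < y'" "x' \<in> I u'" "y \<in> I v" "\<not> x' < y"
        using P unfolding P_def by blast
      moreover from this have "x < y" "x' < y'" using P unfolding P_def by blast+
      ultimately show False by linarith
    qed
  qed
  then show ?thesis by (rule that)
qed

theorem theorem1:
  fixes G :: "'a pair_pre_digraph"
  assumes "pair_graph G" and "interval_graph G"
  shows "list_distinguishing_number G = distinguishing_number G"
proof -
  interpret pair_graph G by fact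
  obtain P where "interval_order_graph (\<lambda>u v. (u, v) \<in> parcs G) (pverts G) P"
    using interval_order_graph_of_interval_graph[OF assms] by blast
  then interpret io: interval_order_graph "\<lambda>u v. (u, v) \<in> parcs G" "pverts G" P .
  let ?V = "pverts G" and ?l = "\<lambda>_. 0 :: nat"
  have V: "finite ?V" by (rule pair_finite_verts)
  have dist: "distinguishing G p \<longleftrightarrow> io.dist_coloring ?V ?l p" for p :: "'a \<Rightarrow> nat"
    by (rule io.distinguishing_iff_dist_coloring) simp
  have "list_distinguishable G k \<longleftrightarrow> distinguishable G k" for k
  proof (rule iffI[rotated])
    assume "distinguishable G k"
    \<comment> \<open>A distinguishing coloring exists exactly if there is a class, so comparing
      numbers of classes transfers existence.\<close>
    then have ne: "io.dist_L_colorings ?V ?l (\<lambda>_. {1..k}) \<noteq> {}"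
      unfolding distinguishable_def dist io.dist_L_colorings_def by blast
    show "list_distinguishable G k"
      unfolding list_distinguishable_def
    proof (intro allI impI)
      fix L :: "'a \<Rightarrow> nat set" assume L: "\<forall>v\<in>?V. finite (L v) \<and> card (L v) = k"
      have "finite (io.code ?V ?l ` io.dist_L_colorings ?V ?l (\<lambda>_. {1..k}))"
        by (rule io.finite_code_image[OF V]) simp
      then have "0 < io.num_classes ?V ?l (\<lambda>_. {1..k})"
        using ne unfolding io.num_classes_def by (simp add: card_gt_0_iff)
      also have "\<dots> \<le> io.num_classes ?V ?l L"
      proof -
        have "io.list_good ?V ?l" by (rule io.list_good_interval[OF V order_refl])
        then show ?thesis
          unfolding io.list_good_def using L by (elim allE[of _ "\<lambda>_. {1..k}"] allE[of _ L]) simp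
      qed
      finally have "io.dist_L_colorings ?V ?l L \<noteq> {}" by (auto simp: io.num_classes_def)
      then show "\<exists>p. distinguishing_L_coloring G L p"
        unfolding distinguishing_L_coloring_def dist io.dist_L_colorings_def by blast
    qed
  next
    assume "list_distinguishable G k"
    \<comment> \<open>Ordinary colorings are those from the constant lists
      \<open>{1..k}\<close>.\<close>
    then have "\<exists>p. distinguishing_L_coloring G (\<lambda>_. {1..k}) p"
      unfolding list_distinguishable_def by (elim allE[of _ "\<lambda>_. {1..k}"]) simp
    then show "distinguishable G k"
      unfolding distinguishable_def distinguishing_L_coloring_def by blast
  qed
  then have "list_distinguishable G = distinguishable G" by (rule ext)
  then show ?thesis
    unfolding list_distinguishing_number_def distinguishing_number_def by simp
qed

end
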